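(* Let $(\bar{a}^*, \bar{d}^*, \bar{e}^*, \bar{f}^*, u^*, q^* )$ be an optimal solution to the conic problem $\mathsf{CP}_1$. For each $(i,j)\in\mathcal{IJ}$ and $1\le k\le K_i$, let $$x_{ijk}^* = \begin{cases} u_{ijk}^*/\bar d_{ijk}^* & \text{if } \bar d_{ijk}^*>0,\\ 0 & \text{otherwise,}\end{cases}\qquad p_{ijk}^* = \frac{\exp(\alpha_{ijk}-\beta_{ij}x_{ijk}^* )}{1+\exp(\alpha_{ijk}-\beta_{ij}x_{ijk}^* )}.$$ Then $(\bar{a}^*, \bar{d}^*, \bar{e}^*, \bar{f}^*, x^*, p^*, q^* )$ is an optimal solution to the problem $\mathsf{FP}_1$.
   Context: **Data.** $\mathcal{I}$ is a finite set of zones. For each $i\in\mathcal{I}$, $\mathcal{I}_i\subseteq\mathcal{I}$ and $\widetilde{\mathcal{I}}_i\subseteq\mathcal{I}$ are the sets of destinations reachable from $i$ with, respectively without, a passenger. Put $\mathcal{IJ}=\{(i,j): i\in\mathcal{I}, j\in\mathcal{I}_i\}$, $\widetilde{\mathcal{IJ}}=\{(i,j): i\in\mathcal{I}, j\in\widetilde{\mathcal{I}}_i\}$, $\mathcal{J}_i=\{j\in\mathcal{I}:(j,i)\in\mathcal{IJ}\}$, $\widetilde{\mathcal{J}}_i=\{j\in\mathcal{I}:(j,i)\in\widetilde{\mathcal{IJ}}\}$. Assume $\mathcal{IJ}\ne\varnothing$ and that the directed graph $(\mathcal{I},\widetilde{\mathcal{IJ}})$ is strongly connected. For each $i\in\mathcal{I}$,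 $K_i\ge1$ is an integer, and $K_0=\max_i K_i$. Parameters: $\omega>0$; $\sigma_i>0$ for $i\in\mathcal{I}$; $\mu_{ij}>0$, $\lambda_{ij}>0$, $\beta_{ij}>0$ for $(i,j)\in\mathcal{IJ}$; $\widetilde\mu_{ij}>0$ for $(i,j)\in\widetilde{\mathcal{IJ}}$; $0<1/\nu_1<\cdots<1/\nu_{K_0}$; $0=\delta_0<\delta_1<\cdots<\delta_{K_0}$; reals $\alpha_{ij1}>\cdots>\alpha_{ijK_i}$ and costs $\phi_{ij1}\le\cdots\le\phi_{ijK_i}$ for $(i,j)\in\mathcal{IJ}$; costs $\psi_{ij}$ for $(i,j)\in\widetilde{\mathcal{IJ}}$. **Variables.** Real vectors $\bar a=(\bar a_i)_{i\in\mathcal{I}}$; $\bar d=(\bar d_{ijk})$, $x=(x_{ijk})$, $p=(p_{ijk})$, $u=(u_{ijk})$ indexed by $(i,j)\in\mathcal{IJ}$, $1\le k\le K_i$; $\bar e=(\bar e_{ij})_{(i,j)\in\widetilde{\mathcal{IJ}}}$; $\bar f=(\bar f_{ij})_{(i,j)\in\mathcal{IJ}}$; $q=(q_{ik})_{i\in\mathcal{I},1\le k\le K_i}$. **Exponential cone.** $\mathcal{K}_{\exp}=\{(a_1,a_2,a_3): a_3\le a_2\log(a_1/a_2), a_1>0,a_2>0\}\cup\{(a_1,0,a_3): a_1\ge0,a_3\le0\}$. **Common linear constraints (L):** - $\sum_{k=1}^{K_i}\nu_k\bar d_{ijk}=\mu_{ij}\bar f_{ij}$ for $(i,j)\in\mathcal{IJ}$;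 - $\sum_{j\in\widetilde{\mathcal{J}}_i}\widetilde\mu_{ji}\bar e_{ji}+\sum_{j\in\mathcal{J}_i}\mu_{ji}\bar f_{ji}=\sum_{j\in\widetilde{\mathcal{I}}_i}\widetilde\mu_{ij}\bar e_{ij}+\sum_{j\in\mathcal{I}_i}\mu_{ij}\bar f_{ij}$ for $i\in\mathcal{I}$; - $\sum_{i\in\mathcal{I}}\big(\bar a_i+\sum_{j\in\widetilde{\mathcal{I}}_i}\bar e_{ij}+\sum_{j\in\mathcal{I}_i}(\bar f_{ij}+\sum_{k=1}^{K_i}\bar d_{ijk})\big)=1$; - $\bar a,\bar d,\bar e,\bar f\ge0$. **Problem $\mathsf{FP}_1$.** Over $(\bar a,\bar d,\bar e,\bar f,x,p,q)$, maximize $$\sum_{(i,j)\in\mathcal{IJ}}\sum_{k=1}^{K_i}\nu_k\bar d_{ijk}(x_{ijk}-\phi_{ijk})-\sum_{(i,j)\in\widetilde{\mathcal{IJ}}}\psi_{ij}\widetilde\mu_{ij}\bar e_{ij}$$ subject to (L) and - $\sum_{k'=1}^k q_{ik'}=1-\exp(-\omega\delta_k^2\bar a_i/\sigma_i)$ for $i\in\mathcal{I}$, $1\le k\le K_i$; - $p_{ijk}=\frac{\exp(\alpha_{ijk}-\beta_{ij}x_{ijk})}{1+\exp(\alpha_{ijk}-\beta_{ij}x_{ijk})}$ and $\lambda_{ij}q_{ik}p_{ijk}=\nu_k\bar d_{ijk}$ for $(i,j)\in\mathcal{IJ}$, $1\le k\le K_i$. **Problem $\mathsf{CP}_1$.**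 Over $(\bar a,\bar d,\bar e,\bar f,u,q)$, maximize $$\sum_{(i,j)\in\mathcal{IJ}}\sum_{k=1}^{K_i}(\nu_k u_{ijk}-\nu_k\phi_{ijk}\bar d_{ijk})-\sum_{(i,j)\in\widetilde{\mathcal{IJ}}}\psi_{ij}\widetilde\mu_{ij}\bar e_{ij}$$ subject to (L), $q\ge0$, and - $\big(1-\sum_{k'=1}^k q_{ik'},\,1,\,-\omega\delta_k^2\bar a_i/\sigma_i\big)\in\mathcal{K}_{\exp}$ for $i\in\mathcal{I}$, $1\le k\le K_i$; - $\big(\lambda_{ij}q_{ik}-\nu_k\bar d_{ijk},\,\nu_k\bar d_{ijk},\,\beta_{ij}\nu_k u_{ijk}-\alpha_{ijk}\nu_k\bar d_{ijk}\big)\in\mathcal{K}_{\exp}$ for $(i,j)\in\mathcal{IJ}$, $1\le k\le K_i$. *)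

theory Defs
  imports Complex_Main
begin

text \<open>
  The suffix \<open>_e\<close> (``empty'') stands for the tilde of the informal notation: trips
  without a passenger. \<open>dest D i\<close> and \<open>dest_e D i\<close> are the destination sets
  reachable from \<open>i\<close>, \<open>lam\<close> is the arrival rate \<open>\<lambda>\<close>. All data and variables are total
  functions, but only their values on the relevant index sets are ever used.
\<close>

record 'z ride_data =
  zones :: "'z set"
  dest :: "'z \<Rightarrow> 'z set"
  dest_e :: "'z \<Rightarrow> 'z set"
  K :: "'z \<Rightarrow> nat"
  \<omega> :: real
  \<sigma> :: "'z \<Rightarrow> real"
  \<mu> :: "'z \<Rightarrow> 'z \<Rightarrow> real"
  \<mu>_e :: "'z \<Rightarrow> 'z \<Rightarrow> real"
  lam :: "'z \<Rightarrow> 'z \<Rightarrow> real"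
  \<beta> :: "'z \<Rightarrow> 'z \<Rightarrow> real"
  \<nu> :: "nat \<Rightarrow> real"
  \<delta> :: "nat \<Rightarrow> real"
  \<alpha> :: "'z \<Rightarrow> 'z \<Rightarrow> nat \<Rightarrow> real"
  \<phi> :: "'z \<Rightarrow> 'z \<Rightarrow> nat \<Rightarrow> real"
  \<psi> :: "'z \<Rightarrow> 'z \<Rightarrow> real"

definition IJ :: "'z ride_data \<Rightarrow> ('z \<times> 'z) set" where
  "IJ D = (SIGMA i:zones D. dest D i)"

definition IJ_e :: "'z ride_data \<Rightarrow> ('z \<times> 'z) set" where
  "IJ_e D = (SIGMA i:zones D. dest_e D i)"

definition orig :: "'z ride_data \<Rightarrow> 'z \<Rightarrow> 'z set" where
  "orig D i = {j \<in> zones D. (j, i) \<in> IJ D}"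

definition orig_e :: "'z ride_data \<Rightarrow> 'z \<Rightarrow> 'z set" where
  "orig_e D i = {j \<in> zones D. (j, i) \<in> IJ_e D}"

definition K0 :: "'z ride_data \<Rightarrow> nat" where
  "K0 D = Max (K D ` zones D)"

definition strongly_connected_on :: "'z set \<Rightarrow> ('z \<times> 'z) set \<Rightarrow> bool" where
  "strongly_connected_on V E \<longleftrightarrow> (\<forall>i\<in>V. \<forall>j\<in>V. (i, j) \<in> E\<^sup>*)"

definition valid_data :: "'z ride_data \<Rightarrow> bool" where
  "valid_data D \<longleftrightarrow>
     finite (zones D) \<and>
     (\<forall>i\<in>zones D. dest D i \<subseteq> zones D \<and> dest_e D i \<subseteq> zones D) \<and>
     IJ D \<noteq> {} \<and>
     strongly_connected_on (zones D) (IJ_e D) \<and>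
     (\<forall>i\<in>zones D. K D i \<ge> 1) \<and>
     \<omega> D > 0 \<and>
     (\<forall>i\<in>zones D. \<sigma> D i > 0) \<and>
     (\<forall>(i, j)\<in>IJ D. \<mu> D i j > 0 \<and> lam D i j > 0 \<and> \<beta> D i j > 0) \<and>
     (\<forall>(i, j)\<in>IJ_e D. \<mu>_e D i j > 0) \<and>
     0 < 1 / \<nu> D 1 \<and>
     (\<forall>k\<in>{1..<K0 D}. 1 / \<nu> D k < 1 / \<nu> D (Suc k)) \<and>
     \<delta> D 0 = 0 \<and>
     (\<forall>k<K0 D. \<delta> D k < \<delta> D (Suc k)) \<and>
     (\<forall>(i, j)\<in>IJ D. \<forall>k\<in>{1..<K D i}. \<alpha> D i j k > \<alpha> D i j (Suc k)) \<and>
     (\<forall>(i, j)\<in>IJ D. \<forall>k\<in>{1..<K D i}. \<phi> D i j k \<le> \<phi> D i j (Suc k))"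

definition K_exp :: "(real \<times> real \<times> real) set" where
  "K_exp = {(a1, a2, a3). a3 \<le> a2 * ln (a1 / a2) \<and> a1 > 0 \<and> a2 > 0}
         \<union> {(a1, a2, a3). a2 = 0 \<and> a1 \<ge> 0 \<and> a3 \<le> 0}"

definition linear_constraints ::
  "'z ride_data \<Rightarrow> ('z \<Rightarrow> real) \<Rightarrow> ('z \<Rightarrow> 'z \<Rightarrow> nat \<Rightarrow> real) \<Rightarrow> ('z \<Rightarrow> 'z \<Rightarrow> real)
     \<Rightarrow> ('z \<Rightarrow> 'z \<Rightarrow> real) \<Rightarrow> bool" where
  "linear_constraints D a d e f \<longleftrightarrow>
     (\<forall>(i, j)\<in>IJ D. (\<Sum>k=1..K D i. \<nu> D k * d i j k) = \<mu> D i j * f i j) \<and>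
     (\<forall>i\<in>zones D.
        (\<Sum>j\<in>orig_e D i. \<mu>_e D j i * e j i) + (\<Sum>j\<in>orig D i. \<mu> D j i * f j i)
        = (\<Sum>j\<in>dest_e D i. \<mu>_e D i j * e i j) + (\<Sum>j\<in>dest D i. \<mu> D i j * f i j)) \<and>
     (\<Sum>i\<in>zones D. a i + (\<Sum>j\<in>dest_e D i. e i j)
        + (\<Sum>j\<in>dest D i. f i j + (\<Sum>k=1..K D i. d i j k))) = 1 \<and>
     (\<forall>i\<in>zones D. a i \<ge> 0) \<and>
     (\<forall>(i, j)\<in>IJ D. \<forall>k\<in>{1..K D i}. d i j k \<ge> 0) \<and>
     (\<forall>(i, j)\<in>IJ_e D. e i j \<ge> 0) \<and>
     (\<forall>(i, j)\<in>IJ D. f i j \<ge> 0)"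

definition FP1_feasible ::
  "'z ride_data \<Rightarrow> ('z \<Rightarrow> real) \<Rightarrow> ('z \<Rightarrow> 'z \<Rightarrow> nat \<Rightarrow> real) \<Rightarrow> ('z \<Rightarrow> 'z \<Rightarrow> real)
     \<Rightarrow> ('z \<Rightarrow> 'z \<Rightarrow> real) \<Rightarrow> ('z \<Rightarrow> 'z \<Rightarrow> nat \<Rightarrow> real) \<Rightarrow> ('z \<Rightarrow> 'z \<Rightarrow> nat \<Rightarrow> real)
     \<Rightarrow> ('z \<Rightarrow> nat \<Rightarrow> real) \<Rightarrow> bool" where
  "FP1_feasible D a d e f x p q \<longleftrightarrow>
     linear_constraints D a d e f \<and>
     (\<forall>i\<in>zones D. \<forall>k\<in>{1..K D i}.
        (\<Sum>k'=1..k. q i k') = 1 - exp (- (\<omega> D * (\<delta> D k)\<^sup>2 * a i / \<sigma> D i))) \<and>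
     (\<forall>(i, j)\<in>IJ D. \<forall>k\<in>{1..K D i}.
        p i j k = exp (\<alpha> D i j k - \<beta> D i j * x i j k) / (1 + exp (\<alpha> D i j k - \<beta> D i j * x i j k)) \<and>
        lam D i j * q i k * p i j k = \<nu> D k * d i j k)"

definition FP1_objective ::
  "'z ride_data \<Rightarrow> ('z \<Rightarrow> 'z \<Rightarrow> nat \<Rightarrow> real) \<Rightarrow> ('z \<Rightarrow> 'z \<Rightarrow> real)
     \<Rightarrow> ('z \<Rightarrow> 'z \<Rightarrow> nat \<Rightarrow> real) \<Rightarrow> real" where
  "FP1_objective D d e x =
     (\<Sum>(i, j)\<in>IJ D. \<Sum>k=1..K D i. \<nu> D k * d i j k * (x i j k - \<phi> D i j k))
     - (\<Sum>(i, j)\<in>IJ_e D. \<psi> D i j * \<mu>_e D i j * e i j)"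

definition FP1_optimal ::
  "'z ride_data \<Rightarrow> ('z \<Rightarrow> real) \<Rightarrow> ('z \<Rightarrow> 'z \<Rightarrow> nat \<Rightarrow> real) \<Rightarrow> ('z \<Rightarrow> 'z \<Rightarrow> real)
     \<Rightarrow> ('z \<Rightarrow> 'z \<Rightarrow> real) \<Rightarrow> ('z \<Rightarrow> 'z \<Rightarrow> nat \<Rightarrow> real) \<Rightarrow> ('z \<Rightarrow> 'z \<Rightarrow> nat \<Rightarrow> real)
     \<Rightarrow> ('z \<Rightarrow> nat \<Rightarrow> real) \<Rightarrow> bool" where
  "FP1_optimal D a d e f x p q \<longleftrightarrow>
     FP1_feasible D a d e f x p q \<and>
     (\<forall>a' d' e' f' x' p' q'. FP1_feasible D a' d' e' f' x' p' q'
        \<longrightarrow> FP1_objective D d' e' x' \<le> FP1_objective D d e x)"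

definition CP1_feasible ::
  "'z ride_data \<Rightarrow> ('z \<Rightarrow> real) \<Rightarrow> ('z \<Rightarrow> 'z \<Rightarrow> nat \<Rightarrow> real) \<Rightarrow> ('z \<Rightarrow> 'z \<Rightarrow> real)
     \<Rightarrow> ('z \<Rightarrow> 'z \<Rightarrow> real) \<Rightarrow> ('z \<Rightarrow> 'z \<Rightarrow> nat \<Rightarrow> real) \<Rightarrow> ('z \<Rightarrow> nat \<Rightarrow> real) \<Rightarrow> bool" where
  "CP1_feasible D a d e f u q \<longleftrightarrow>
     linear_constraints D a d e f \<and>
     (\<forall>i\<in>zones D. \<forall>k\<in>{1..K D i}. q i k \<ge> 0) \<and>
     (\<forall>i\<in>zones D. \<forall>k\<in>{1..K D i}.
        (1 - (\<Sum>k'=1..k. q i k'), 1, - (\<omega> D * (\<delta> D k)\<^sup>2 * a i / \<sigma> D i)) \<in> K_exp) \<and>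
     (\<forall>(i, j)\<in>IJ D. \<forall>k\<in>{1..K D i}.
        (lam D i j * q i k - \<nu> D k * d i j k,
         \<nu> D k * d i j k,
         \<beta> D i j * \<nu> D k * u i j k - \<alpha> D i j k * \<nu> D k * d i j k) \<in> K_exp)"

definition CP1_objective ::
  "'z ride_data \<Rightarrow> ('z \<Rightarrow> 'z \<Rightarrow> nat \<Rightarrow> real) \<Rightarrow> ('z \<Rightarrow> 'z \<Rightarrow> real)
     \<Rightarrow> ('z \<Rightarrow> 'z \<Rightarrow> nat \<Rightarrow> real) \<Rightarrow> real" where
  "CP1_objective D d e u =
     (\<Sum>(i, j)\<in>IJ D. \<Sum>k=1..K D i. \<nu> D k * u i j k - \<nu> D k * \<phi> D i j k * d i j k)
     - (\<Sum>(i, j)\<in>IJ_e D. \<psi> D i j * \<mu>_e D i j * e i j)"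

definition CP1_optimal ::
  "'z ride_data \<Rightarrow> ('z \<Rightarrow> real) \<Rightarrow> ('z \<Rightarrow> 'z \<Rightarrow> nat \<Rightarrow> real) \<Rightarrow> ('z \<Rightarrow> 'z \<Rightarrow> real)
     \<Rightarrow> ('z \<Rightarrow> 'z \<Rightarrow> real) \<Rightarrow> ('z \<Rightarrow> 'z \<Rightarrow> nat \<Rightarrow> real) \<Rightarrow> ('z \<Rightarrow> nat \<Rightarrow> real) \<Rightarrow> bool" where
  "CP1_optimal D a d e f u q \<longleftrightarrow>
     CP1_feasible D a d e f u q \<and>
     (\<forall>a' d' e' f' u' q'. CP1_feasible D a' d' e' f' u' q'
        \<longrightarrow> CP1_objective D d' e' u' \<le> CP1_objective D d e u)"

end

theory Submission
  imports Defs
begin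

text \<open>
  Substituting \<open>u = d x\<close> embeds the feasible set of \<open>FP\<^sub>1\<close> into that of the convex problem
  \<open>CP\<^sub>1\<close> with the same objective value, so it suffices that every optimal point of \<open>CP\<^sub>1\<close>
  satisfies the relaxed constraints with equality. The logit cone constraint is tight because the
  revenue \<open>u\<close> would otherwise be raised. If \<open>q\<^sub>i\<^sub>k > 0\<close> then \<open>d\<^sub>i\<^sub>j\<^sub>k > 0\<close>, since the revenue has
  infinite slope at \<open>d\<^sub>i\<^sub>j\<^sub>k = 0\<close>; strong connectedness provides the feasible point towards which
  one moves. Finally, slack in the bound on \<open>q\<^sub>i\<^sub>1 + \<dots> + q\<^sub>i\<^sub>k\<close> lets one either raise \<open>q\<^sub>i\<^sub>k\<close>,
  or move trips from the next ring with \<open>q\<^sub>i\<^sub>l > 0\<close>, \<open>l > k\<close>, to the nearer and more profitable ring \<open>k\<close>.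
\<close>

section \<open>The exponential cone\<close>

lemma K_exp_pos_iff: "b > 0 \<Longrightarrow> (s, b, c) \<in> K_exp \<longleftrightarrow> s > 0 \<and> c \<le> b * ln (s / b)"
  by (auto simp: K_exp_def)

lemma K_exp_zero_iff: "(s, 0, c) \<in> K_exp \<longleftrightarrow> s \<ge> 0 \<and> c \<le> 0"
  by (auto simp: K_exp_def)

text \<open>With second entry 1 the bound is \<open>- c \<le> ln s\<close>; exponentiating it also
  absorbs the condition \<open>s > 0\<close>.\<close>

lemma K_exp_one_iff: "(s, 1, - c) \<in> K_exp \<longleftrightarrow> exp (- c) \<le> s"
proof -
  have "s > 0 \<and> - c \<le> ln s \<longleftrightarrow> exp (- c) \<le> s"
    by (metis exp_gt_zero less_le_trans ln_ge_iff)
  then show ?thesis by (simp add: K_exp_pos_iff)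
qed

text \<open>The log-sum inequality. Since \<open>b * ln (s / b)\<close> is homogeneous of degree
  one, its superadditivity is its joint concavity, which makes the exponential cone convex.\<close>

lemma log_sum_two:
  fixes s b s' b' :: real
  assumes "s > 0" "b > 0" "s' > 0" "b' > 0"
  shows "b * ln (s / b) + b' * ln (s' / b') \<le> (b + b') * ln ((s + s') / (b + b'))"
proof -
  define r where "r = (s + s') / (b + b')"
  have r: "r > 0" using assms by (simp add: r_def)
  \<comment> \<open>The tangent to \<open>ln\<close> at the pooled ratio \<open>r\<close> bounds
    both terms; at this ratio the linear remainders cancel in the sum.\<close>
  have tangent: "v * ln (w / v) \<le> v * ln r + w / r - v" if "v > 0" "w > 0" for v w :: real
  proof -
    have "ln (w / v / r) \<le> w / v / r - 1" using that r by (intro ln_le_minus_one) simp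
    then have "ln (w / v) \<le> ln r + (w / v / r - 1)" using that r by (simp add: ln_div ln_mult)
    then have "v * ln (w / v) \<le> v * (ln r + (w / v / r - 1))" using that by (intro mult_left_mono) auto
    also have "\<dots> = v * ln r + w / r - v" using that by (simp add: algebra_simps)
    finally show ?thesis .
  qed
  have "s / r + s' / r = b + b'"
    unfolding add_divide_distrib[symmetric] using assms by (simp add: r_def)
  then show ?thesis
    using tangent[OF assms(2,1)] tangent[OF assms(4,3)]
    by (simp add: r_def[symmetric] distrib_right)
qed

lemma K_exp_mono:
  assumes "(s, b, c) \<in> K_exp" "s \<le> s'" "c' \<le> c"
  shows "(s', b, c') \<in> K_exp"
proof (cases "b = 0")
  case True
  then show ?thesis using assms by (auto simp: K_exp_zero_iff)
next
  case False
  then have b: "b > 0" using assms(1) by (auto simp: K_exp_def)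
  then have s: "s > 0" "c \<le> b * ln (s / b)" using assms(1) by (auto simp: K_exp_pos_iff)
  have "b * ln (s / b) \<le> b * ln (s' / b)"
    using s(1) b assms(2) by (intro mult_left_mono) (auto simp: divide_right_mono)
  then have "c' \<le> b * ln (s' / b)" using s(2) assms(3) by linarith
  then show ?thesis using b s(1) assms(2) by (simp add: K_exp_pos_iff)
qed

text \<open>Interior points add by the log-sum inequality. A summand with second entry 0 only
  enlarges the first entry and lowers the third, so monotonicity suffices.\<close>

lemma K_exp_add:
  assumes "(s, b, c) \<in> K_exp" "(s', b', c') \<in> K_exp"
  shows "(s + s', b + b', c + c') \<in> K_exp"
proof -
  consider "b = 0" | "b' = 0" | "b > 0" "b' > 0"
    using assms by (auto simp: K_exp_def)
  then show ?thesis
  proof cases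
    case 1
    then show ?thesis using assms K_exp_mono[OF assms(2), of "s + s'" "c + c'"]
      by (auto simp: K_exp_zero_iff)
  next
    case 2
    then show ?thesis using assms K_exp_mono[OF assms(1), of "s + s'" "c + c'"]
      by (auto simp: K_exp_zero_iff)
  next
    case 3
    then show ?thesis using assms log_sum_two[of s b s' b'] by (auto simp: K_exp_pos_iff)
  qed
qed

lemma K_exp_scale:
  assumes "(s, b, c) \<in> K_exp" "t \<ge> 0"
  shows "(t * s, t * b, t * c) \<in> K_exp"
proof (cases "t = 0 \<or> b = 0")
  case True
  then show ?thesis using assms by (auto simp: K_exp_zero_iff mult_nonneg_nonpos)
next
  case False
  then have "t > 0" "b > 0" using assms by (auto simp: K_exp_def)
  then show ?thesis using assms by (auto simp: K_exp_pos_iff)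
qed

lemma K_exp_convex:
  assumes "(s, b, c) \<in> K_exp" "(s', b', c') \<in> K_exp" "0 \<le> t" "t \<le> 1"
  shows "((1 - t) * s + t * s', (1 - t) * b + t * b', (1 - t) * c + t * c') \<in> K_exp"
  using assms by (intro K_exp_add K_exp_scale) auto

section \<open>Data and convexity of the conic problem\<close>

lemma ball_case_prod_iff: "(\<forall>(i, j)\<in>A. P i j) \<longleftrightarrow> (\<forall>i j. (i, j) \<in> A \<longrightarrow> P i j)"
  by auto

text \<open>The data are ordered by conditions on consecutive indices; transitivity extends them to
  any two rings.\<close>

lemma relation_along_chain:
  assumes "transp R" "\<forall>k\<in>{m..<n}. R (f k) (f (Suc k))" "m \<le> k" "k < k'" "k' \<le> n"
  shows "R (f k) (f (k'::nat))"
  using assms(4,5)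
proof (induction k')
  case (Suc l)
  have step: "R (f l) (f (Suc l))" using assms(2,3) Suc.prems by auto
  show ?case
  proof (cases "k = l")
    case False
    then have "R (f k) (f l)" using Suc by auto
    then show ?thesis using step assms(1) by (meson transpD)
  qed (use step in simp)
qed simp

text \<open>Bookkeeping for moving mass between rings: \<open>A\<close> arrives at \<open>k\<close>,
  \<open>B\<close> leaves \<open>k'\<close>, and each counts only if its index lies in the range of
  summation.\<close>

lemma sum_shift:
  fixes c X :: "nat \<Rightarrow> real"
  assumes "1 \<le> k" "1 \<le> k'"
  shows "(\<Sum>l=1..L. c l * (X l + ((if l = k then A else 0) - (if l = k' then B else 0))))
    = (\<Sum>l=1..L. c l * X l) + (if k \<le> L then c k * A else 0) - (if k' \<le> L then c k' * B else 0)"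
proof -
  have "(\<Sum>l=1..L. c l * (X l + ((if l = k then A else 0) - (if l = k' then B else 0))))
    = (\<Sum>l=1..L. c l * X l + (if l = k then c k * A else 0) - (if l = k' then c k' * B else 0))"
    by (intro sum.cong) (auto simp: algebra_simps)
  also have "\<dots> = (\<Sum>l=1..L. c l * X l) + (\<Sum>l=1..L. if l = k then c k * A else 0)
      - (\<Sum>l=1..L. if l = k' then c k' * B else 0)"
    by (simp only: sum.distrib sum_subtractf)
  finally show ?thesis using assms by (simp add: sum.delta)
qed

section \<open>Consequences of the assumptions on the data\<close>

locale ride =
  fixes D :: "'z ride_data"
  assumes valid: "valid_data D"
begin

lemma finite_zones [simp]: "finite (zones D)"
  using valid by (simp add: valid_data_def)

lemma finite_dest [simp]: "i \<in> zones D \<Longrightarrow> finite (dest D i)"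
  and finite_dest_e [simp]: "i \<in> zones D \<Longrightarrow> finite (dest_e D i)"
  using valid finite_subset[OF _ finite_zones] by (simp_all add: valid_data_def)

lemma finite_orig [simp]: "finite (orig D i)" and finite_orig_e [simp]: "finite (orig_e D i)"
  by (simp_all add: orig_def orig_e_def)

lemma finite_IJ [simp]: "finite (IJ D)"
  by (simp add: IJ_def)

lemma IJ_zones: "(i, j) \<in> IJ D \<Longrightarrow> i \<in> zones D \<and> j \<in> zones D"
  and IJ_e_zones: "(i, j) \<in> IJ_e D \<Longrightarrow> i \<in> zones D \<and> j \<in> zones D"
  using valid by (auto simp: IJ_def IJ_e_def valid_data_def)

lemma omega_pos: "\<omega> D > 0" and sigma_pos: "i \<in> zones D \<Longrightarrow> \<sigma> D i > 0"
  using valid by (auto simp: valid_data_def)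

lemma IJ_pos:
  assumes "(i, j) \<in> IJ D"
  shows "\<mu> D i j > 0" "lam D i j > 0" "\<beta> D i j > 0"
  using valid assms by (auto simp: valid_data_def)

lemma mu_e_pos: "(i, j) \<in> IJ_e D \<Longrightarrow> \<mu>_e D i j > 0"
  using valid by (auto simp: valid_data_def)

lemma K_le_K0: "i \<in> zones D \<Longrightarrow> K D i \<le> K0 D"
  by (simp add: K0_def)

lemma inverse_nu_less:
  assumes "i \<in> zones D" "1 \<le> k" "k < k'" "k' \<le> K D i"
  shows "1 / \<nu> D k < 1 / \<nu> D k'"
  using relation_along_chain[of "(<)" 1 "K0 D" "\<lambda>k. 1 / \<nu> D k" k k'] assms K_le_K0[of i] valid
  by (auto simp: valid_data_def)

text \<open>The assumptions order the reciprocals, so positivity is carried from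
  \<open>1 / \<nu> D 1\<close> up the chain.\<close>

lemma nu_pos:
  assumes "i \<in> zones D" "k \<in> {1..K D i}"
  shows "\<nu> D k > 0"
proof -
  have "0 < 1 / \<nu> D 1" using valid by (simp add: valid_data_def)
  moreover have "1 / \<nu> D 1 \<le> 1 / \<nu> D k"
    using inverse_nu_less[of i 1 k] assms by (cases "k = 1") auto
  ultimately have "0 < 1 / \<nu> D k" by linarith
  then show ?thesis by simp
qed

lemma alpha_greater:
  assumes "(i, j) \<in> IJ D" "1 \<le> k" "k < k'" "k' \<le> K D i"
  shows "\<alpha> D i j k > \<alpha> D i j k'"
proof -
  have "\<forall>k\<in>{1..<K D i}. \<alpha> D i j k > \<alpha> D i j (Suc k)"
    using valid assms by (auto simp: valid_data_def)
  then show ?thesis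
    using relation_along_chain[of "(>)" 1 "K D i" "\<alpha> D i j" k k'] assms by auto
qed

lemma phi_le:
  assumes "(i, j) \<in> IJ D" "1 \<le> k" "k < k'" "k' \<le> K D i"
  shows "\<phi> D i j k \<le> \<phi> D i j k'"
proof -
  have "\<forall>k\<in>{1..<K D i}. \<phi> D i j k \<le> \<phi> D i j (Suc k)"
    using valid assms by (auto simp: valid_data_def)
  then show ?thesis
    using relation_along_chain[of "(\<le>)" 1 "K D i" "\<phi> D i j" k k'] assms by auto
qed

lemma delta_less:
  assumes "i \<in> zones D" "k < k'" "k' \<le> K D i"
  shows "\<delta> D k < \<delta> D k'"
  using relation_along_chain[of "(<)" 0 "K0 D" "\<delta> D" k k'] assms K_le_K0[of i] valid
  by (auto simp: valid_data_def)

lemma delta_pos: "i \<in> zones D \<Longrightarrow> k \<in> {1..K D i} \<Longrightarrow> \<delta> D k > 0"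
  using delta_less[of i 0 k] valid by (auto simp: valid_data_def)

text \<open>The exponent in the pickup constraint at idle mass \<open>s\<close>. The perturbation
  arguments rest on its growth both in \<open>s\<close> and in the ring \<open>k\<close>.\<close>

definition load :: "'z \<Rightarrow> nat \<Rightarrow> real \<Rightarrow> real" where
  "load i k s = \<omega> D * (\<delta> D k)\<^sup>2 * s / \<sigma> D i"

lemma load_0 [simp]: "load i k 0 = 0"
  by (simp add: load_def)

lemma load_mono:
  assumes "i \<in> zones D" "s \<le> s'"
  shows "load i k s \<le> load i k s'"
  using assms omega_pos sigma_pos[of i]
  by (auto simp: load_def intro!: divide_right_mono mult_left_mono)

lemma load_strict_mono:
  assumes "i \<in> zones D" "k \<in> {1..K D i}" "s < s'"
  shows "load i k s < load i k s'"
  using assms omega_pos sigma_pos[of i] delta_pos[of i k]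
  by (auto simp: load_def intro!: divide_strict_right_mono mult_strict_left_mono)

lemma load_mono_index:
  assumes "i \<in> zones D" "1 \<le> k" "k \<le> k'" "k' \<le> K D i" "0 \<le> s"
  shows "load i k s \<le> load i k' s"
proof -
  have "\<delta> D k \<le> \<delta> D k'" using delta_less[of i k k'] assms by (cases "k = k'") auto
  then have "(\<delta> D k)\<^sup>2 \<le> (\<delta> D k')\<^sup>2"
    using delta_pos[of i k] assms by (intro power_mono) auto
  then show ?thesis using assms omega_pos sigma_pos[of i]
    by (auto simp: load_def intro!: divide_right_mono mult_right_mono mult_left_mono)
qed

lemma CP1_feasible_iff:
  "CP1_feasible D a d e f u q \<longleftrightarrow>
     linear_constraints D a d e f \<and>
     (\<forall>i\<in>zones D. \<forall>k\<in>{1..K D i}. q i k \<ge> 0) \<and>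
     (\<forall>i\<in>zones D. \<forall>k\<in>{1..K D i}. exp (- load i k (a i)) \<le> 1 - (\<Sum>k'=1..k. q i k')) \<and>
     (\<forall>(i, j)\<in>IJ D. \<forall>k\<in>{1..K D i}.
        (lam D i j * q i k - \<nu> D k * d i j k, \<nu> D k * d i j k,
         \<beta> D i j * \<nu> D k * u i j k - \<alpha> D i j k * \<nu> D k * d i j k) \<in> K_exp)"
  by (simp add: CP1_feasible_def K_exp_one_iff load_def)

section \<open>Convex combinations of feasible points\<close>

lemma linear_constraints_convex:
  assumes "linear_constraints D a d e f" "linear_constraints D a' d' e' f'" "0 \<le> t" "t \<le> 1"
  shows "linear_constraints D (\<lambda>i. (1 - t) * a i + t * a' i)
    (\<lambda>i j k. (1 - t) * d i j k + t * d' i j k)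
    (\<lambda>i j. (1 - t) * e i j + t * e' i j) (\<lambda>i j. (1 - t) * f i j + t * f' i j)"
proof -
  let ?c = "\<lambda>r s. (1 - t) * r + t * s"
  \<comment> \<open>These equations pull the convex combination out of every sum and product, so
    that each constraint becomes the combination of the two given ones.\<close>
  have lin: "(\<Sum>x\<in>A. c x * ?c (g x) (h x)) = ?c (\<Sum>x\<in>A. c x * g x) (\<Sum>x\<in>A. c x * h x)"
    for A :: "'b set" and c g h
    unfolding sum_distrib_left sum.distrib[symmetric] by (simp add: algebra_simps)
  have lin1: "(\<Sum>x\<in>A. ?c (g x) (h x)) = ?c (sum g A) (sum h A)" for A :: "'b set" and g h
    by (simp add: sum_distrib_left sum.distrib)
  have add: "?c r s + ?c r' s' = ?c (r + r') (s + s')" for r s r' s'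
    by (simp add: algebra_simps)
  have scale: "c * ?c r s = ?c (c * r) (c * s)" for c r s
    by (simp add: algebra_simps)
  have one: "?c 1 1 = 1" by simp
  show ?thesis
    using assms unfolding linear_constraints_def lin lin1 add scale ball_case_prod_iff
    by (auto simp: one)
qed

lemma CP1_feasible_convex:
  assumes "CP1_feasible D a d e f u q" "CP1_feasible D a' d' e' f' u' q'" "0 \<le> t" "t \<le> 1"
  shows "CP1_feasible D (\<lambda>i. (1 - t) * a i + t * a' i)
    (\<lambda>i j k. (1 - t) * d i j k + t * d' i j k)
    (\<lambda>i j. (1 - t) * e i j + t * e' i j) (\<lambda>i j. (1 - t) * f i j + t * f' i j)
    (\<lambda>i j k. (1 - t) * u i j k + t * u' i j k) (\<lambda>i k. (1 - t) * q i k + t * q' i k)"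
  unfolding CP1_feasible_def
proof (intro conjI ballI case_prodI2)
  show "linear_constraints D (\<lambda>i. (1 - t) * a i + t * a' i)
    (\<lambda>i j k. (1 - t) * d i j k + t * d' i j k)
    (\<lambda>i j. (1 - t) * e i j + t * e' i j) (\<lambda>i j. (1 - t) * f i j + t * f' i j)"
    using assms by (intro linear_constraints_convex) (auto simp: CP1_feasible_def)
next
  fix i k assume "i \<in> zones D" "k \<in> {1..K D i}"
  then show "(1 - t) * q i k + t * q' i k \<ge> 0"
    using assms by (auto simp: CP1_feasible_def)
next
  fix i k assume ik: "i \<in> zones D" "k \<in> {1..K D i}"
  have "((1 - t) * (1 - (\<Sum>k'=1..k. q i k')) + t * (1 - (\<Sum>k'=1..k. q' i k')), (1 - t) * 1 + t * 1,
    (1 - t) * - (\<omega> D * (\<delta> D k)\<^sup>2 * a i / \<sigma> D i) + t * - (\<omega> D * (\<delta> D k)\<^sup>2 * a' i / \<sigma> D i)) \<in> K_exp"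
    using assms ik by (intro K_exp_convex) (auto simp: CP1_feasible_def)
  moreover have "(1 - t) * - (\<omega> D * (\<delta> D k)\<^sup>2 * a i / \<sigma> D i) + t * - (\<omega> D * (\<delta> D k)\<^sup>2 * a' i / \<sigma> D i)
    = - (\<omega> D * (\<delta> D k)\<^sup>2 * ((1 - t) * a i + t * a' i) / \<sigma> D i)"
    using sigma_pos[OF ik(1)] by (simp add: field_simps)
  moreover have "(1 - t) * (1 - (\<Sum>k'=1..k. q i k')) + t * (1 - (\<Sum>k'=1..k. q' i k'))
    = 1 - (\<Sum>k'=1..k. (1 - t) * q i k' + t * q' i k')"
    unfolding sum.distrib sum_distrib_left[symmetric] by (simp add: algebra_simps)
  ultimately show "(1 - (\<Sum>k'=1..k. (1 - t) * q i k' + t * q' i k'), 1,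
    - (\<omega> D * (\<delta> D k)\<^sup>2 * ((1 - t) * a i + t * a' i) / \<sigma> D i)) \<in> K_exp"
    by simp
next
  fix ij i j k assume ij: "ij \<in> IJ D" "ij = (i, j)" and k: "k \<in> {1..K D i}"
  have "((1 - t) * (lam D i j * q i k - \<nu> D k * d i j k) + t * (lam D i j * q' i k - \<nu> D k * d' i j k),
    (1 - t) * (\<nu> D k * d i j k) + t * (\<nu> D k * d' i j k),
    (1 - t) * (\<beta> D i j * \<nu> D k * u i j k - \<alpha> D i j k * \<nu> D k * d i j k)
     + t * (\<beta> D i j * \<nu> D k * u' i j k - \<alpha> D i j k * \<nu> D k * d' i j k)) \<in> K_exp"
    using assms ij k by (intro K_exp_convex) (auto simp: CP1_feasible_def)
  then show "(lam D i j * ((1 - t) * q i k + t * q' i k) - \<nu> D k * ((1 - t) * d i j k + t * d' i j k),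
    \<nu> D k * ((1 - t) * d i j k + t * d' i j k),
    \<beta> D i j * \<nu> D k * ((1 - t) * u i j k + t * u' i j k)
     - \<alpha> D i j k * \<nu> D k * ((1 - t) * d i j k + t * d' i j k)) \<in> K_exp"
    by (rule back_subst[of "\<lambda>v. v \<in> K_exp"]) (simp add: algebra_simps)
qed

lemma CP1_objective_convex:
  "CP1_objective D (\<lambda>i j k. (1 - t) * d i j k + t * d' i j k)
     (\<lambda>i j. (1 - t) * e i j + t * e' i j) (\<lambda>i j k. (1 - t) * u i j k + t * u' i j k)
   = (1 - t) * CP1_objective D d e u + t * CP1_objective D d' e' u'"
  unfolding CP1_objective_def
  by (simp add: right_diff_distrib sum_distrib_left case_prod_beta sum.distrib[symmetric]
        sum_subtractf[symmetric] algebra_simps)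

section \<open>Perturbations that leave most variables fixed\<close>

lemma CP1_objective_upd:
  assumes "(i, j) \<in> IJ D" "k \<in> {1..K D i}"
  shows "CP1_objective D d e (\<lambda>i' j' k'. if i' = i \<and> j' = j \<and> k' = k then v else u i' j' k')
    = CP1_objective D d e u + \<nu> D k * (v - u i j k)"
proof -
  let ?u = "\<lambda>i' j' k'. if i' = i \<and> j' = j \<and> k' = k then v else u i' j' k'"
  let ?T = "\<lambda>u i j k. \<nu> D k * u i j k - \<nu> D k * \<phi> D i j k * d i j k"
  have inner: "(\<Sum>k'=1..K D i'. ?T ?u i' j' k') = (\<Sum>k'=1..K D i'. ?T u i' j' k')
     + (if (i', j') = (i, j) then \<nu> D k * (v - u i j k) else 0)" for i' j'
  proof (cases "(i', j') = (i, j)")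
    case True
    have "(\<Sum>k'=1..K D i. ?T ?u i j k')
        = (\<Sum>k'=1..K D i. ?T u i j k' + (if k' = k then \<nu> D k * (v - u i j k) else 0))"
      by (intro sum.cong) (auto simp: algebra_simps)
    also have "\<dots> = (\<Sum>k'=1..K D i. ?T u i j k') + \<nu> D k * (v - u i j k)"
      unfolding sum.distrib using assms(2) by (simp add: sum.delta)
    finally show ?thesis using True by auto
  qed auto
  have "(\<Sum>(i', j')\<in>IJ D. \<Sum>k'=1..K D i'. ?T ?u i' j' k')
    = (\<Sum>(i', j')\<in>IJ D. \<Sum>k'=1..K D i'. ?T u i' j' k')
     + (\<Sum>ij\<in>IJ D. if ij = (i, j) then \<nu> D k * (v - u i j k) else 0)"
    unfolding inner by (simp add: case_prod_beta sum.distrib prod_eq_iff)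
  then show ?thesis using assms(1) by (simp add: CP1_objective_def)
qed

text \<open>Each revenue variable occurs in a single cone constraint, so only that one has to be
  rechecked.\<close>

lemma CP1_feasible_upd:
  assumes "CP1_feasible D a d e f u q"
    and "(lam D i j * q i k - \<nu> D k * d i j k, \<nu> D k * d i j k,
         \<beta> D i j * \<nu> D k * v - \<alpha> D i j k * \<nu> D k * d i j k) \<in> K_exp"
  shows "CP1_feasible D a d e f (\<lambda>i' j' k'. if i' = i \<and> j' = j \<and> k' = k then v else u i' j' k') q"
  using assms by (auto simp: CP1_feasible_def)

text \<open>Replacing \<open>u i j k\<close> by \<open>v\<close> stays feasible and changes the
  objective by \<open>\<nu> D k * (v - u i j k)\<close>, with \<open>\<nu> D k > 0\<close>.\<close>

lemma CP1_optimal_revenue_maximal: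
  assumes opt: "CP1_optimal D a d e f u q" and ij: "(i, j) \<in> IJ D" and k: "k \<in> {1..K D i}"
    and v: "(lam D i j * q i k - \<nu> D k * d i j k, \<nu> D k * d i j k,
         \<beta> D i j * \<nu> D k * v - \<alpha> D i j k * \<nu> D k * d i j k) \<in> K_exp"
  shows "v \<le> u i j k"
proof -
  have feas: "CP1_feasible D a d e f u q" using opt by (simp add: CP1_optimal_def)
  have "CP1_objective D d e (\<lambda>i' j' k'. if i' = i \<and> j' = j \<and> k' = k then v else u i' j' k')
      \<le> CP1_objective D d e u"
    using opt CP1_feasible_upd[OF feas, OF v] unfolding CP1_optimal_def by blast
  then have "\<nu> D k * (v - u i j k) \<le> 0" by (simp add: CP1_objective_upd[OF ij k])
  then show ?thesis using nu_pos[of i k] IJ_zones[OF ij] k by (simp add: mult_le_0_iff)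
qed

lemma CP1_feasible_d_zeroD:
  assumes "CP1_feasible D a d e f u q" "(i, j) \<in> IJ D" "k \<in> {1..K D i}" "d i j k = 0"
  shows "u i j k \<le> 0"
proof -
  have "\<beta> D i j * \<nu> D k * u i j k \<le> 0"
    using assms unfolding CP1_feasible_def by (fastforce simp: K_exp_zero_iff)
  moreover have "\<beta> D i j * \<nu> D k > 0"
    using IJ_pos[OF assms(2)] nu_pos[of i k] IJ_zones[OF assms(2)] assms(3) by simp
  ultimately show ?thesis by (meson mult_pos_pos not_less)
qed

text \<open>The objective sees only \<open>d\<close>, \<open>e\<close> and \<open>u\<close>, so idle
  drivers and match probabilities may be rearranged within the optimal set.\<close>

lemma CP1_optimal_same_value:
  assumes "CP1_optimal D a d e f u q" "CP1_feasible D a' d e f u q'"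
  shows "CP1_optimal D a' d e f u q'"
  using assms by (simp add: CP1_optimal_def)

subsection \<open>Feasible points serving a prescribed edge\<close>

text \<open>One unit is sent along a path from \<open>s\<close> to \<open>t\<close>. An edge
  traversed repeatedly accumulates flow, so the path need not be simple.\<close>

lemma unit_flow:
  assumes "(s, t) \<in> (IJ_e D)\<^sup>*"
  shows "\<exists>g :: 'z \<Rightarrow> 'z \<Rightarrow> real. (\<forall>m n. g m n \<ge> 0) \<and>
    (\<forall>m\<in>zones D. (\<Sum>n\<in>orig_e D m. g n m) + of_bool (m = s)
        = (\<Sum>n\<in>dest_e D m. g m n) + of_bool (m = t))"
  using assms
proof (induction rule: rtrancl_induct)
  case base
  show ?case by (rule exI[of _ "\<lambda>_ _. 0"]) simp
next
  case (step y z)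
  then obtain g :: "'z \<Rightarrow> 'z \<Rightarrow> real" where g: "\<forall>m n. g m n \<ge> 0"
    and bal: "\<And>m. m \<in> zones D \<Longrightarrow> (\<Sum>n\<in>orig_e D m. g n m) + of_bool (m = s)
        = (\<Sum>n\<in>dest_e D m. g m n) + of_bool (m = y)"
    by blast
  \<comment> \<open>One more unit on the edge from \<open>y\<close> to \<open>z\<close> moves the
    sink from \<open>y\<close> to \<open>z\<close>.\<close>
  define h where "h m n = g m n + (if m = y \<and> n = z then 1 else 0)" for m n
  have "(\<Sum>n\<in>orig_e D m. h n m) + of_bool (m = s) = (\<Sum>n\<in>dest_e D m. h m n) + of_bool (m = z)"
    if m: "m \<in> zones D" for m
  proof -
    have "y \<in> orig_e D z" "z \<in> dest_e D y"
      using step.hyps(2) IJ_e_zones[OF step.hyps(2)] by (auto simp: orig_e_def IJ_e_def)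
    then have "(\<Sum>n\<in>orig_e D m. if n = y \<and> m = z then 1 else 0) = (of_bool (m = z) :: real)"
      by (cases "m = z") simp_all
    moreover have "(\<Sum>n\<in>dest_e D m. if m = y \<and> n = z then 1 else 0) = (of_bool (m = y) :: real)"
      using \<open>z \<in> dest_e D y\<close> m by (cases "m = y") simp_all
    ultimately show ?thesis using bal[OF m] by (simp add: h_def sum.distrib)
  qed
  moreover have "\<forall>m n. h m n \<ge> 0" using g by (simp add: h_def)
  ultimately show ?case by blast
qed

text \<open>Passenger trips at rate \<open>r\<close> from \<open>i\<close> to \<open>j\<close> are
  closed into a circulation by empty trips from \<open>j\<close> back to \<open>i\<close>, which
  strong connectedness permits. The remaining drivers idle at \<open>i\<close>.\<close>

lemma linear_constraints_single_edge:
  assumes ij: "(i, j) \<in> IJ D" and k: "k \<in> {1..K D i}"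
  obtains M :: real and e where "M \<ge> 0" and
    "\<And>r. 0 \<le> r \<Longrightarrow> r * M \<le> 1 \<Longrightarrow> linear_constraints D (\<lambda>m. if m = i then 1 - r * M else 0)
      (\<lambda>m n l. if m = i \<and> n = j \<and> l = k then r / \<nu> D k else 0) (\<lambda>m n. r * e m n)
      (\<lambda>m n. if m = i \<and> n = j then r / \<mu> D i j else 0)"
proof -
  have i: "i \<in> zones D" and j: "j \<in> zones D" and ji: "j \<in> dest D i" and ioj: "i \<in> orig D j"
    using IJ_zones[OF ij] ij by (auto simp: IJ_def orig_def)
  have "(j, i) \<in> (IJ_e D)\<^sup>*"
    using valid i j by (simp add: valid_data_def strongly_connected_on_def)
  then obtain g :: "'z \<Rightarrow> 'z \<Rightarrow> real" where g: "\<And>m n. g m n \<ge> 0"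
    and bal: "\<And>m. m \<in> zones D \<Longrightarrow> (\<Sum>n\<in>orig_e D m. g n m) + of_bool (m = j)
        = (\<Sum>n\<in>dest_e D m. g m n) + of_bool (m = i)"
    using unit_flow by blast
  \<comment> \<open>The flow \<open>g\<close> is a rate; dividing by \<open>\<mu>_e\<close> gives
    the mass of drivers on the edge.\<close>
  define e where "e m n = g m n / \<mu>_e D m n" for m n
  \<comment> \<open>The driver mass that the circulation occupies per unit of rate: empty trips, the
    passenger trip and the pickup.\<close>
  define M where "M = (\<Sum>m\<in>zones D. \<Sum>n\<in>dest_e D m. e m n) + 1 / \<mu> D i j + 1 / \<nu> D k"
  have nu: "\<nu> D k > 0" and mu: "\<mu> D i j > 0" using nu_pos[OF i k] IJ_pos[OF ij] by auto
  have e0: "e m n \<ge> 0" if "(m, n) \<in> IJ_e D" for m n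
    using g[of m n] mu_e_pos[OF that] by (simp add: e_def)
  have e_g: "\<mu>_e D m n * (r * e m n) = r * g m n" if "(m, n) \<in> IJ_e D" for m n r
    using mu_e_pos[OF that] by (simp add: e_def)
  have "M \<ge> 0" unfolding M_def using e0 nu mu
    by (intro add_nonneg_nonneg sum_nonneg) (auto simp: IJ_e_def)
  moreover have "linear_constraints D (\<lambda>m. if m = i then 1 - r * M else 0)
      (\<lambda>m n l. if m = i \<and> n = j \<and> l = k then r / \<nu> D k else 0) (\<lambda>m n. r * e m n)
      (\<lambda>m n. if m = i \<and> n = j then r / \<mu> D i j else 0)"
    (is "linear_constraints D ?a ?d ?e ?f") if r: "0 \<le> r" "r * M \<le> 1" for r
    unfolding linear_constraints_def
  proof (intro conjI ballI case_prodI2)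
    fix mn m n assume "mn \<in> IJ D" "mn = (m, n)"
    have "(\<Sum>l=1..K D m. \<nu> D l * ?d m n l)
        = (\<Sum>l=1..K D m. if l = k then (if m = i \<and> n = j then r else 0) else 0)"
      using nu by (intro sum.cong) auto
    also have "\<dots> = (if m = i \<and> n = j then r else 0)" using k by (auto simp: sum.delta)
    also have "\<dots> = \<mu> D m n * ?f m n" using mu by auto
    finally show "(\<Sum>l=1..K D m. \<nu> D l * ?d m n l) = \<mu> D m n * ?f m n" .
  next
    fix m assume m: "m \<in> zones D"
    have "(\<Sum>n\<in>orig_e D m. \<mu>_e D n m * ?e n m) = r * (\<Sum>n\<in>orig_e D m. g n m)"
      unfolding sum_distrib_left by (intro sum.cong e_g) (auto simp: orig_e_def)
    moreover have "(\<Sum>n\<in>dest_e D m. \<mu>_e D m n * ?e m n) = r * (\<Sum>n\<in>dest_e D m. g m n)"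
      unfolding sum_distrib_left using m by (intro sum.cong e_g) (auto simp: IJ_e_def)
    moreover have "(\<Sum>n\<in>orig D m. \<mu> D n m * ?f n m) = r * of_bool (m = j)"
    proof -
      have "(\<Sum>n\<in>orig D m. \<mu> D n m * ?f n m) = (\<Sum>n\<in>orig D m. if n = i then r * of_bool (m = j) else 0)"
        using mu by (intro sum.cong) auto
      also have "\<dots> = r * of_bool (m = j)" using ioj by (auto simp: sum.delta)
      finally show ?thesis .
    qed
    moreover have "(\<Sum>n\<in>dest D m. \<mu> D m n * ?f m n) = r * of_bool (m = i)"
    proof -
      have "(\<Sum>n\<in>dest D m. \<mu> D m n * ?f m n) = (\<Sum>n\<in>dest D m. if n = j then r * of_bool (m = i) else 0)"
        using mu by (intro sum.cong) auto
      also have "\<dots> = r * of_bool (m = i)" using ji m by (auto simp: sum.delta)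
      finally show ?thesis .
    qed
    ultimately show "(\<Sum>n\<in>orig_e D m. \<mu>_e D n m * ?e n m) + (\<Sum>n\<in>orig D m. \<mu> D n m * ?f n m)
        = (\<Sum>n\<in>dest_e D m. \<mu>_e D m n * ?e m n) + (\<Sum>n\<in>dest D m. \<mu> D m n * ?f m n)"
      using arg_cong[OF bal[OF m], of "\<lambda>v. r * v"] by (simp only: distrib_left)
  next
    have inner: "(\<Sum>n\<in>dest D m. ?f m n + (\<Sum>l=1..K D m. ?d m n l))
        = (if m = i then r / \<mu> D i j + r / \<nu> D k else 0)" if m: "m \<in> zones D" for m
    proof -
      have "?f m n + (\<Sum>l=1..K D m. ?d m n l)
          = (if n = j then if m = i then r / \<mu> D i j + r / \<nu> D k else 0 else 0)" for n
      proof -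
        have "(\<Sum>l=1..K D m. ?d m n l)
          = (\<Sum>l=1..K D m. if l = k then (if m = i \<and> n = j then r / \<nu> D k else 0) else 0)"
          by (intro sum.cong) auto
        also have "\<dots> = (if m = i \<and> n = j then r / \<nu> D k else 0)" using k by (auto simp: sum.delta)
        finally show ?thesis by simp
      qed
      then show ?thesis using m ji by (auto simp: sum.delta)
    qed
    have "(\<Sum>m\<in>zones D. ?a m + (\<Sum>n\<in>dest_e D m. ?e m n)
        + (\<Sum>n\<in>dest D m. ?f m n + (\<Sum>l=1..K D m. ?d m n l)))
      = (\<Sum>m\<in>zones D. ?a m + r * (\<Sum>n\<in>dest_e D m. e m n)
        + (if m = i then r / \<mu> D i j + r / \<nu> D k else 0))"
      by (intro sum.cong refl arg_cong2[of _ _ _ _ "(+)"] inner) (simp add: sum_distrib_left)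
    also have "\<dots> = (1 - r * M) + r * (\<Sum>m\<in>zones D. \<Sum>n\<in>dest_e D m. e m n)
        + (r / \<mu> D i j + r / \<nu> D k)"
      unfolding sum.distrib using i by (simp add: sum.delta sum_distrib_left[symmetric])
    also have "\<dots> = 1" by (simp add: M_def algebra_simps)
    finally show "(\<Sum>m\<in>zones D. ?a m + (\<Sum>n\<in>dest_e D m. ?e m n)
        + (\<Sum>n\<in>dest D m. ?f m n + (\<Sum>l=1..K D m. ?d m n l))) = 1" .
  qed (use r nu mu e0 in auto)
  ultimately show thesis by (rule that)
qed

text \<open>A small enough rate keeps half of the drivers idle at \<open>i\<close>, which supports a
  fixed match probability on ring \<open>k\<close> that exceeds what the rate uses up.\<close>

lemma CP1_feasible_positive_demand:
  assumes ij: "(i, j) \<in> IJ D" and k: "k \<in> {1..K D i}"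
  obtains a d e f u q where "CP1_feasible D a d e f u q" "d i j k > 0"
proof -
  obtain M :: real and e where M: "M \<ge> 0" and
    lin: "\<And>r. 0 \<le> r \<Longrightarrow> r * M \<le> 1 \<Longrightarrow> linear_constraints D (\<lambda>m. if m = i then 1 - r * M else 0)
      (\<lambda>m n l. if m = i \<and> n = j \<and> l = k then r / \<nu> D k else 0) (\<lambda>m n. r * e m n)
      (\<lambda>m n. if m = i \<and> n = j then r / \<mu> D i j else 0)"
    using linear_constraints_single_edge[OF ij k] by metis
  have i: "i \<in> zones D" using IJ_zones[OF ij] by simp
  have nu: "\<nu> D k > 0" and pos: "lam D i j > 0" "\<beta> D i j > 0"
    using nu_pos[OF i k] IJ_pos[OF ij] by auto
  \<comment> \<open>The probability that idle mass 1/2 supports on ring \<open>k\<close>; all other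
    entries of \<open>q\<close> will be 0.\<close>
  define B where "B = 1 - exp (- load i k (1 / 2))"
  have B: "B > 0" using load_strict_mono[OF i k, of 0 "1/2"] by (simp add: B_def)
  \<comment> \<open>The first bound leaves at least half of the drivers idle; the second makes
    \<open>lam D i j * B - r\<close> strictly positive.\<close>
  define r where "r = min (1 / (2 * (M + 1))) (lam D i j * B / 2)"
  have r: "r > 0" using M B pos by (simp add: r_def)
  have "r * M \<le> 1 / (2 * (M + 1)) * M" using M by (intro mult_right_mono) (auto simp: r_def)
  also have "\<dots> \<le> 1 / 2" using M by (simp add: field_simps)
  finally have rM: "r * M \<le> 1 / 2" .
  have rB: "r < lam D i j * B"
    using B pos by (auto simp: r_def min_less_iff_disj)
  let ?a = "\<lambda>m. if m = i then 1 - r * M else 0"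
  let ?d = "\<lambda>m n l. if m = i \<and> n = j \<and> l = k then r / \<nu> D k else 0"
  let ?f = "\<lambda>m n. if m = i \<and> n = j then r / \<mu> D i j else 0"
  \<comment> \<open>The revenue that turns the cone constraint at \<open>(i, j, k)\<close> into an
    equality.\<close>
  let ?u = "\<lambda>m n l. if m = i \<and> n = j \<and> l = k
    then (\<alpha> D i j k * r + r * ln ((lam D i j * B - r) / r)) / (\<beta> D i j * \<nu> D k) else 0"
  let ?q = "\<lambda>m l. if m = i \<and> l = k then B else 0"
  have "CP1_feasible D ?a ?d (\<lambda>m n. r * e m n) ?f ?u ?q"
    unfolding CP1_feasible_iff
  proof (intro conjI ballI case_prodI2)
    show "linear_constraints D ?a ?d (\<lambda>m n. r * e m n) ?f" using r rM by (intro lin) auto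
  next
    fix m l assume m: "m \<in> zones D" and l: "l \<in> {1..K D m}"
    show "?q m l \<ge> 0" using B by simp
    have "(\<Sum>k'=1..l. ?q m k') = (\<Sum>k'=1..l. if k' = k then (if m = i then B else 0) else 0)"
      by (intro sum.cong) auto
    also have "\<dots> = (if k \<le> l \<and> m = i then B else 0)" using k by (auto simp: sum.delta)
    finally have Q: "(\<Sum>k'=1..l. ?q m k') = (if k \<le> l \<and> m = i then B else 0)" .
    \<comment> \<open>Rings from \<open>k\<close> on have at least the load that defines
      \<open>B\<close>; below \<open>k\<close> the partial sum is 0 and a nonnegative load
      suffices.\<close>
    have "load i k (1 / 2) \<le> load i l (1 - r * M)" if "k \<le> l" "m = i"
      using load_mono_index[of i k l "1 / 2"] load_mono[OF i, of "1 / 2" "1 - r * M" l] that k l i rM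
      by auto
    moreover have "load i l (1 - r * M) \<ge> 0" using load_mono[OF i, of 0 "1 - r * M" l] rM by simp
    ultimately show "exp (- load m l (?a m)) \<le> 1 - (\<Sum>k'=1..l. ?q m k')"
      unfolding Q by (auto simp: B_def)
  next
    fix mn m n l assume mn: "mn \<in> IJ D" "mn = (m, n)" and l: "l \<in> {1..K D m}"
    show "(lam D m n * ?q m l - \<nu> D l * ?d m n l, \<nu> D l * ?d m n l,
         \<beta> D m n * \<nu> D l * ?u m n l - \<alpha> D m n l * \<nu> D l * ?d m n l) \<in> K_exp"
    proof (cases "m = i \<and> n = j \<and> l = k")
      case True
      then show ?thesis using nu r rB pos by (simp add: K_exp_pos_iff)
    next
      case False
      then have "?d m n l = 0" "?u m n l = 0" by auto
      moreover have "lam D m n * ?q m l \<ge> 0" using B IJ_pos[of m n] mn by simp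
      ultimately show ?thesis by (simp only: K_exp_zero_iff mult_zero_right diff_zero) simp
    qed
  qed
  moreover have "?d i j k > 0" using r nu by simp
  ultimately show thesis by (rule that)
qed

subsection \<open>Tightness at the optimum\<close>

text \<open>Mixing in a weight \<open>t\<close> of a feasible point that serves \<open>(i, j, k)\<close> costs at most
  \<open>O(t)\<close>, but the concave revenue gained there is of order \<open>t ln (1 / t)\<close>.\<close>

lemma CP1_optimal_demand_pos:
  assumes opt: "CP1_optimal D a d e f u q" and ij: "(i, j) \<in> IJ D" and k: "k \<in> {1..K D i}"
    and q: "q i k > 0"
  shows "d i j k > 0"
proof (rule ccontr)
  assume "\<not> d i j k > 0"
  have feas: "CP1_feasible D a d e f u q" using opt by (simp add: CP1_optimal_def)
  then have "d i j k \<ge> 0" using ij k by (auto simp: CP1_feasible_def linear_constraints_def)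
  then have d0: "d i j k = 0" using \<open>\<not> d i j k > 0\<close> by simp
  have u0: "u i j k \<le> 0" by (rule CP1_feasible_d_zeroD[OF feas ij k d0])
  obtain a' d' e' f' u' q' where feas': "CP1_feasible D a' d' e' f' u' q'" and d': "d' i j k > 0"
    using CP1_feasible_positive_demand[OF ij k] by metis
  have nu: "\<nu> D k > 0" using nu_pos[of i k] IJ_zones[OF ij] k by simp
  have pos: "lam D i j > 0" "\<beta> D i j > 0" using IJ_pos[OF ij] by auto
  define y where "y = \<nu> D k * d' i j k"
  have y: "y > 0" using nu d' by (simp add: y_def)
  have "(lam D i j * q' i k - y, y, \<beta> D i j * \<nu> D k * u' i j k - \<alpha> D i j k * \<nu> D k * d' i j k) \<in> K_exp"
    using feas' ij k unfolding CP1_feasible_def y_def by fastforce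
  then have q': "lam D i j * q' i k - y > 0" using y by (simp add: K_exp_pos_iff)
  define G where "G = CP1_objective D d e u"
  define G' where "G' = CP1_objective D d' e' u'"
  \<comment> \<open>At mixing weight \<open>t\<close> the revenue term attainable at
    \<open>(i, j, k)\<close> is \<open>t * y * (A - ln t)\<close> up to the factor
    \<open>\<beta>\<close>. The constant \<open>C\<close> collects everything else that is linear in
    \<open>t\<close>.\<close>
  define A where "A = \<alpha> D i j k + ln (lam D i j * q i k / (2 * y))"
  define C where "C = (G - G' + \<nu> D k * u' i j k) * \<beta> D i j / y - A"
  have bound: "- ln t \<le> C" if t: "0 < t" "t \<le> 1 / 2" for t
  proof -
    let ?d = "\<lambda>i j k. (1 - t) * d i j k + t * d' i j k"
    let ?e = "\<lambda>i j. (1 - t) * e i j + t * e' i j"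
    let ?u = "\<lambda>i j k. (1 - t) * u i j k + t * u' i j k"
    let ?q = "\<lambda>i k. (1 - t) * q i k + t * q' i k"
    let ?a = "\<lambda>i. (1 - t) * a i + t * a' i"
    let ?f = "\<lambda>i j. (1 - t) * f i j + t * f' i j"
    \<comment> \<open>The revenue giving equality in the cone once the first entry is replaced by
      its lower bound \<open>lam D i j * q i k / 2\<close>.\<close>
    define v where "v = t * y * (A - ln t) / (\<beta> D i j * \<nu> D k)"
    have conv: "CP1_feasible D ?a ?d ?e ?f ?u ?q"
      using CP1_feasible_convex[OF feas feas', of t] t by simp
    have yd: "\<nu> D k * ?d i j k = t * y" by (simp add: d0 y_def)
    \<comment> \<open>As \<open>t \<le> 1 / 2\<close>, the first entry stays above a bound
      independent of \<open>t\<close>, so \<open>ln (1 / t)\<close> survives in the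
      logarithm.\<close>
    have "lam D i j * q i k / 2 \<le> (1 - t) * (lam D i j * q i k)"
    proof -
      have "1 / 2 * (lam D i j * q i k) \<le> (1 - t) * (lam D i j * q i k)"
        using t pos q by (intro mult_right_mono) auto
      then show ?thesis by simp
    qed
    also have "\<dots> \<le> (1 - t) * (lam D i j * q i k) + t * (lam D i j * q' i k - y)"
      using t q' by simp
    also have "\<dots> = lam D i j * ?q i k - t * y" by (simp add: algebra_simps)
    finally have slack: "lam D i j * q i k / 2 \<le> lam D i j * ?q i k - t * y" .
    have "ln (lam D i j * q i k / 2 / (t * y)) = ln (lam D i j * q i k / (2 * y)) - ln t"
      using pos q t y by (simp add: ln_div ln_mult)
    then have "\<beta> D i j * \<nu> D k * v - \<alpha> D i j k * (t * y) = t * y * ln (lam D i j * q i k / 2 / (t * y))"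
    proof -
      have "\<beta> D i j * \<nu> D k * v = t * y * (A - ln t)" using pos nu by (simp add: v_def)
      then show ?thesis using \<open>ln (lam D i j * q i k / 2 / (t * y)) = _\<close>
        by (simp add: A_def ring_distribs)
    qed
    moreover have "lam D i j * q i k / 2 > 0" using pos q by simp
    moreover have "t * y > 0" using t y by simp
    ultimately have "(lam D i j * q i k / 2, t * y, \<beta> D i j * \<nu> D k * v - \<alpha> D i j k * (t * y)) \<in> K_exp"
      by (simp add: K_exp_pos_iff)
    then have "(lam D i j * ?q i k - t * y, t * y, \<beta> D i j * \<nu> D k * v - \<alpha> D i j k * (t * y)) \<in> K_exp"
      by (rule K_exp_mono) (use slack in auto)
    then have cone: "(lam D i j * ?q i k - \<nu> D k * ?d i j k, \<nu> D k * ?d i j k,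
         \<beta> D i j * \<nu> D k * v - \<alpha> D i j k * \<nu> D k * ?d i j k) \<in> K_exp"
      by (simp only: yd mult.assoc)
    have "CP1_objective D ?d ?e (\<lambda>i' j' k'. if i' = i \<and> j' = j \<and> k' = k then v else ?u i' j' k') \<le> G"
      using opt CP1_feasible_upd[OF conv, OF cone] unfolding CP1_optimal_def G_def by blast
    then have "(1 - t) * G + t * G' + \<nu> D k * (v - ?u i j k) \<le> G"
      unfolding CP1_objective_upd[OF ij k] CP1_objective_convex G_def G'_def .
    \<comment> \<open>The share of the old revenue is dropped because
      \<open>u i j k \<le> 0\<close>.\<close>
    moreover have "\<nu> D k * ?u i j k \<le> \<nu> D k * (t * u' i j k)"
      using nu u0 t by (intro mult_left_mono) (auto simp: mult_nonneg_nonpos)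
    ultimately have "\<nu> D k * v \<le> t * (G - G' + \<nu> D k * u' i j k)"
      by (simp add: algebra_simps)
    also have "\<nu> D k * v = t * (y * (A - ln t) / \<beta> D i j)" using nu by (simp add: v_def)
    finally have "y * (A - ln t) / \<beta> D i j \<le> G - G' + \<nu> D k * u' i j k"
      using t(1) by (simp only: mult_le_cancel_left_pos)
    then have "A - ln t \<le> (G - G' + \<nu> D k * u' i j k) * \<beta> D i j / y"
      using y pos by (simp add: field_simps)
    then show ?thesis by (simp add: C_def)
  qed
  \<comment> \<open>The weight \<open>exp (- (\<bar>C\<bar> + 1))\<close> is at most 1/2, and its
    negative logarithm exceeds \<open>C\<close>.\<close>
  have "exp (1::real) \<ge> 2" using exp_ge_add_one_self[of 1] by simp
  then have "exp (- 1 :: real) \<le> 1 / 2" by (simp add: exp_minus field_simps)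
  moreover have "exp (- (\<bar>C\<bar> + 1)) \<le> exp (- 1)" by simp
  ultimately have "exp (- (\<bar>C\<bar> + 1)) \<le> 1 / 2" by linarith
  then show False using bound[of "exp (- (\<bar>C\<bar> + 1))"] by simp
qed

text \<open>Raising \<open>q i k\<close> enlarges every partial sum from \<open>k\<close> on, hence
  slack at all those rings. The objective is unchanged, but the larger first cone entry then admits
  a strictly higher revenue.\<close>

lemma CP1_optimal_probability_maximal:
  assumes opt: "CP1_optimal D a d e f u q" and ij: "(i, j) \<in> IJ D" and k: "k \<in> {1..K D i}"
    and \<epsilon>: "\<epsilon> > 0"
    and bound: "\<And>l. l \<in> {k..K D i} \<Longrightarrow> exp (- load i l (a i)) \<le> 1 - (\<Sum>k'=1..l. q i k') - \<epsilon>"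
  shows False
proof -
  let ?q = "\<lambda>m l. q m l + (if m = i \<and> l = k then \<epsilon> else 0)"
  have feas: "CP1_feasible D a d e f u q" using opt by (simp add: CP1_optimal_def)
  have i: "i \<in> zones D" using IJ_zones[OF ij] by simp
  have Q: "(\<Sum>k'=1..l. ?q m k') = (\<Sum>k'=1..l. q m k') + (if m = i \<and> k \<le> l then \<epsilon> else 0)" for m l
  proof -
    have "(\<Sum>k'=1..l. if m = i \<and> k' = k then \<epsilon> else 0)
        = (\<Sum>k'=1..l. if k' = k then (if m = i then \<epsilon> else 0) else 0)"
      by (intro sum.cong) auto
    also have "\<dots> = (if m = i \<and> k \<le> l then \<epsilon> else 0)" using k by (auto simp: sum.delta)
    finally show ?thesis by (simp add: sum.distrib)
  qed
  have "CP1_feasible D a d e f u ?q"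
    unfolding CP1_feasible_iff
  proof (intro conjI ballI case_prodI2)
    show "linear_constraints D a d e f" using feas by (simp add: CP1_feasible_iff)
  next
    fix m l assume ml: "m \<in> zones D" "l \<in> {1..K D m}"
    show "?q m l \<ge> 0" using feas ml \<epsilon> by (simp add: CP1_feasible_iff)
    show "exp (- load m l (a m)) \<le> 1 - (\<Sum>k'=1..l. ?q m k')"
      unfolding Q using feas ml bound[of l] by (auto simp: CP1_feasible_iff)
  next
    fix mn m n l assume mn: "mn \<in> IJ D" "mn = (m, n)" and l: "l \<in> {1..K D m}"
    have "(lam D m n * q m l - \<nu> D l * d m n l, \<nu> D l * d m n l,
         \<beta> D m n * \<nu> D l * u m n l - \<alpha> D m n l * \<nu> D l * d m n l) \<in> K_exp"
      using feas mn l unfolding CP1_feasible_iff by fastforce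
    then show "(lam D m n * ?q m l - \<nu> D l * d m n l, \<nu> D l * d m n l,
         \<beta> D m n * \<nu> D l * u m n l - \<alpha> D m n l * \<nu> D l * d m n l) \<in> K_exp"
      by (rule K_exp_mono) (use IJ_pos[of m n] mn \<epsilon> in auto)
  qed
  \<comment> \<open>Demand is shown positive at the raised point, which is still optimal with the
    same \<open>d\<close>; this also covers \<open>q i k = 0\<close>.\<close>
  then have opt': "CP1_optimal D a d e f u ?q" by (rule CP1_optimal_same_value[OF opt])
  have "q i k \<ge> 0" using feas i k by (simp add: CP1_feasible_iff)
  then have "?q i k > 0" using \<epsilon> by simp
  then have d: "d i j k > 0" by (rule CP1_optimal_demand_pos[OF opt' ij k])
  define y where "y = \<nu> D k * d i j k"
  have nu: "\<nu> D k > 0" using nu_pos[OF i k] .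
  have pos: "lam D i j > 0" "\<beta> D i j > 0" using IJ_pos[OF ij] by auto
  have y: "y > 0" using nu d by (simp add: y_def)
  have "(lam D i j * q i k - y, y, \<beta> D i j * \<nu> D k * u i j k - \<alpha> D i j k * \<nu> D k * d i j k) \<in> K_exp"
    using feas ij k unfolding CP1_feasible_def y_def by fastforce
  then have cone: "lam D i j * q i k - y > 0"
    "\<beta> D i j * \<nu> D k * u i j k - \<alpha> D i j k * y \<le> y * ln ((lam D i j * q i k - y) / y)"
    using y by (auto simp: K_exp_pos_iff y_def mult.assoc)
  \<comment> \<open>The largest revenue that the cone constraint admits after the raise.\<close>
  define v where "v = (\<alpha> D i j k * y + y * ln ((lam D i j * (q i k + \<epsilon>) - y) / y)) / (\<beta> D i j * \<nu> D k)"
  have v: "\<beta> D i j * \<nu> D k * v = \<alpha> D i j k * y + y * ln ((lam D i j * (q i k + \<epsilon>) - y) / y)"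
    using pos nu by (simp add: v_def)
  have more: "lam D i j * q i k - y < lam D i j * (q i k + \<epsilon>) - y"
    using pos \<epsilon> by (simp add: algebra_simps)
  have "v \<le> u i j k"
  proof (rule CP1_optimal_revenue_maximal[OF opt' ij k])
    have "(lam D i j * (q i k + \<epsilon>) - y, y, \<beta> D i j * \<nu> D k * v - \<alpha> D i j k * y) \<in> K_exp"
      using y cone(1) more v by (simp add: K_exp_pos_iff)
    then show "(lam D i j * ?q i k - \<nu> D k * d i j k, \<nu> D k * d i j k,
         \<beta> D i j * \<nu> D k * v - \<alpha> D i j k * \<nu> D k * d i j k) \<in> K_exp"
      by (simp add: y_def mult.assoc)
  qed
  then have "\<beta> D i j * \<nu> D k * v \<le> \<beta> D i j * \<nu> D k * u i j k"
    using pos nu by (intro mult_left_mono) auto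
  moreover have "y * ln ((lam D i j * q i k - y) / y) < y * ln ((lam D i j * (q i k + \<epsilon>) - y) / y)"
  proof (rule mult_strict_left_mono[OF _ y])
    show "ln ((lam D i j * q i k - y) / y) < ln ((lam D i j * (q i k + \<epsilon>) - y) / y)"
      using cone(1) more y by (subst ln_less_cancel_iff) (auto intro: divide_strict_right_mono)
  qed
  ultimately show False using v cone(2) by linarith
qed

text \<open>Serving the same rate of trips from a nearer ring \<open>k < k'\<close> takes less pickup time
  (the time saved is added to \<open>a i\<close>), tolerates a strictly higher price and costs no more.\<close>

lemma CP1_optimal_no_shift:
  assumes opt: "CP1_optimal D a d e f u q" and ij: "(i, j) \<in> IJ D"
    and k: "1 \<le> k" "k < k'" "k' \<le> K D i" and s: "0 < s" "s \<le> 1" and q: "q i k' > 0"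
    and bound: "\<And>l. l \<in> {k..<k'} \<Longrightarrow>
      exp (- load i l (a i)) \<le> 1 - (\<Sum>k'=1..l. q i k') - s * q i k'"
  shows False
proof -
  have feas: "CP1_feasible D a d e f u q" using opt by (simp add: CP1_optimal_def)
  have lin: "linear_constraints D a d e f" using feas by (simp add: CP1_feasible_iff)
  have i: "i \<in> zones D" using IJ_zones[OF ij] by simp
  have dest: "(i, n) \<in> IJ D \<longleftrightarrow> n \<in> dest D i" for n using i by (simp add: IJ_def)
  have kk: "k \<in> {1..K D i}" "k' \<in> {1..K D i}" using k by auto
  have k'1: "1 \<le> k'" and kK: "k \<le> K D i" using k by auto
  have nu: "\<nu> D k > 0" "\<nu> D k' > 0" using nu_pos[OF i] kk by auto
  have d0: "d i n k' \<ge> 0" if "(i, n) \<in> IJ D" for n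
    using lin that kk unfolding linear_constraints_def ball_case_prod_iff by auto
  define y where "y n = \<nu> D k' * d i n k'" for n
  \<comment> \<open>The price increase that offsets the higher \<open>\<alpha>\<close> of the nearer
    ring, leaving the odds of acceptance unchanged.\<close>
  define gain where "gain n = (\<alpha> D i n k - \<alpha> D i n k') / \<beta> D i n" for n
  \<comment> \<open>A fraction \<open>s\<close> of ring \<open>k'\<close> is moved. Its trip rate
    \<open>s * y n\<close> is kept, so it occupies mass \<open>s * y n / \<nu> D k\<close> in ring
    \<open>k\<close>.\<close>
  define d' where "d' m n l = (if m = i then d i n l
    + ((if l = k then s * y n / \<nu> D k else 0) - (if l = k' then s * d i n k' else 0)) else d m n l)" for m n l
  define u' where "u' m n l = (if m = i then u i n l
    + ((if l = k then s * (\<nu> D k' * u i n k' + y n * gain n) / \<nu> D k else 0)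
       - (if l = k' then s * u i n k' else 0)) else u m n l)" for m n l
  define q' where "q' m l = (if m = i then q i l
    + ((if l = k then s * q i k' else 0) - (if l = k' then s * q i k' else 0)) else q m l)" for m l
  define a' where "a' m = (if m = i then a i + (\<Sum>n\<in>dest D i. s * (d i n k' - y n / \<nu> D k)) else a m)" for m
  have gain: "gain n > 0" if "(i, n) \<in> IJ D" for n
    using alpha_greater[OF that k] IJ_pos[OF that] by (simp add: gain_def)
  have y0: "y n \<ge> 0" if "(i, n) \<in> IJ D" for n using d0[OF that] nu by (simp add: y_def)
  have "s * (d i n k' - y n / \<nu> D k) \<ge> 0" if "n \<in> dest D i" for n
  proof -
    \<comment> \<open>The nearer ring has the smaller \<open>1 / \<nu>\<close>, so the same rate
      occupies less mass.\<close>
    have "y n * (1 / \<nu> D k) \<le> y n * (1 / \<nu> D k')"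
      using inverse_nu_less[OF i k] y0[of n] dest that by (intro mult_left_mono) auto
    also have "\<dots> = d i n k'" using nu by (simp add: y_def)
    finally show ?thesis using s by simp
  qed
  then have a': "a' m \<ge> a m" for m
    by (auto simp: a'_def intro: sum_nonneg)
  have d'_sum: "(\<Sum>l=1..K D i. c l * d' i n l)
      = (\<Sum>l=1..K D i. c l * d i n l) + c k * (s * y n / \<nu> D k) - c k' * (s * d i n k')" for c n
    unfolding d'_def using sum_shift[OF k(1) k'1, of c "d i n"] kK k(3) by simp
  have u'_sum: "(\<Sum>l=1..K D i. \<nu> D l * u' i n l) = (\<Sum>l=1..K D i. \<nu> D l * u i n l) + s * (y n * gain n)" for n
  proof -
    have "(\<Sum>l=1..K D i. \<nu> D l * u' i n l) = (\<Sum>l=1..K D i. \<nu> D l * u i n l)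
        + \<nu> D k * (s * (\<nu> D k' * u i n k' + y n * gain n) / \<nu> D k) - \<nu> D k' * (s * u i n k')"
      unfolding u'_def using sum_shift[OF k(1) k'1, of "\<nu> D" "u i n"] kK k(3) by simp
    moreover have "\<nu> D k * (s * (\<nu> D k' * u i n k' + y n * gain n) / \<nu> D k)
        = s * (\<nu> D k' * u i n k' + y n * gain n)"
      using nu by simp
    ultimately show ?thesis by (simp add: algebra_simps)
  qed
  have q'_sum: "(\<Sum>l=1..L. q' i l) = (\<Sum>l=1..L. q i l) + (if k \<le> L then s * q i k' else 0)
      - (if k' \<le> L then s * q i k' else 0)" for L
    unfolding q'_def using sum_shift[OF k(1) k'1, of "\<lambda>_. 1" "q i"] by simp
  have cone: "(lam D m n * q m l - \<nu> D l * d m n l, \<nu> D l * d m n l,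
         \<beta> D m n * \<nu> D l * u m n l - \<alpha> D m n l * \<nu> D l * d m n l) \<in> K_exp"
    if "(m, n) \<in> IJ D" "l \<in> {1..K D m}" for m n l
    using feas that unfolding CP1_feasible_iff ball_case_prod_iff by blast
  have q0: "q m l \<ge> 0" if "m \<in> zones D" "l \<in> {1..K D m}" for m l
    using feas that unfolding CP1_feasible_iff by blast
  have sd: "(1 - s) * d i n k' \<ge> 0" if "(i, n) \<in> IJ D" for n using d0[OF that] s by simp
  have "CP1_feasible D a' d' e f u' q'"
    unfolding CP1_feasible_iff ball_case_prod_iff
  proof (intro conjI ballI allI impI)
    have mass: "a' m + E + (\<Sum>n\<in>dest D m. f m n + (\<Sum>l=1..K D m. d' m n l))
        = a m + E + (\<Sum>n\<in>dest D m. f m n + (\<Sum>l=1..K D m. d m n l))" for m E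
    proof (cases "m = i")
      case True
      have "(\<Sum>n\<in>dest D i. f i n + (\<Sum>l=1..K D i. d' i n l))
        = (\<Sum>n\<in>dest D i. (f i n + (\<Sum>l=1..K D i. d i n l)) - s * (d i n k' - y n / \<nu> D k))"
        using d'_sum[of "\<lambda>_. 1"] by (intro sum.cong) (auto simp: algebra_simps)
      also have "\<dots> = (\<Sum>n\<in>dest D i. f i n + (\<Sum>l=1..K D i. d i n l))
          - (\<Sum>n\<in>dest D i. s * (d i n k' - y n / \<nu> D k))"
        by (rule sum_subtractf)
      finally show ?thesis using True by (simp add: a'_def)
    qed (simp add: a'_def d'_def)
    \<comment> \<open>Trip rates per destination are preserved, so \<open>f\<close> and the flow
      balance can stay as they are.\<close>
    have rate: "(\<Sum>l=1..K D m. \<nu> D l * d' m n l) = (\<Sum>l=1..K D m. \<nu> D l * d m n l)" for m n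
      using d'_sum[of "\<nu> D" n] nu by (cases "m = i") (auto simp: d'_def y_def)
    have "d' m n l \<ge> 0" if "(m, n) \<in> IJ D" "l \<in> {1..K D m}" for m n l
    proof -
      have "d m n l \<ge> 0"
        using lin that unfolding linear_constraints_def ball_case_prod_iff by auto
      moreover have "s * y n / \<nu> D k \<ge> 0" if "m = i"
        using y0 \<open>(m, n) \<in> IJ D\<close> that s nu by simp
      ultimately show ?thesis using sd[of n] that(1) k(2) by (auto simp: d'_def algebra_simps)
    qed
    moreover have "a' m \<ge> 0" if "m \<in> zones D" for m
      using lin a'[of m] that unfolding linear_constraints_def by fastforce
    ultimately show "linear_constraints D a' d' e f"
      using lin unfolding linear_constraints_def ball_case_prod_iff mass rate by blast
  next
    fix m l assume m: "m \<in> zones D" and l: "l \<in> {1..K D m}"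
    have "(1 - s) * q i k' \<ge> 0" using s q by simp
    then show "q' m l \<ge> 0"
      using q0[OF m l] s q k(2) by (auto simp: q'_def algebra_simps)
    have old: "exp (- load m l (a m)) \<le> 1 - (\<Sum>k'=1..l. q m k')"
      using feas m l unfolding CP1_feasible_iff by blast
    have "exp (- load m l (a m)) \<le> 1 - (\<Sum>k'=1..l. q' m k')"
    proof (cases "m = i")
      case True
      \<comment> \<open>Only the partial sums with \<open>k \<le> l < k'\<close> grow; from
        \<open>k'\<close> on the two changes cancel.\<close>
      then show ?thesis using old bound[of l] k(2) by (auto simp: q'_sum[simplified])
    next
      case False
      then show ?thesis using old by (simp add: q'_def)
    qed
    moreover have "exp (- load m l (a' m)) \<le> exp (- load m l (a m))"
      using load_mono[OF m a'] by simp
    ultimately show "exp (- load m l (a' m)) \<le> 1 - (\<Sum>k'=1..l. q' m k')" by linarith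
  next
    fix m n l assume mn: "(m, n) \<in> IJ D" and l: "l \<in> {1..K D m}"
    consider "m = i" "l = k" | "m = i" "l = k'" | "m \<noteq> i \<or> (l \<noteq> k \<and> l \<noteq> k')" by blast
    then show "(lam D m n * q' m l - \<nu> D l * d' m n l, \<nu> D l * d' m n l,
         \<beta> D m n * \<nu> D l * u' m n l - \<alpha> D m n l * \<nu> D l * d' m n l) \<in> K_exp"
    proof cases
      case 1
      have new: "q' i k = q i k + s * q i k'" "\<nu> D k * d' i n k = \<nu> D k * d i n k + s * (\<nu> D k' * d i n k')"
        "\<nu> D k * u' i n k = \<nu> D k * u i n k + s * (\<nu> D k' * u i n k' + y n * gain n)"
        using k(2) nu by (simp_all add: q'_def d'_def u'_def y_def field_simps)
      \<comment> \<open>The new triple at \<open>k\<close> is the old one plus \<open>s\<close>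
        times the old triple at \<open>k'\<close>; \<open>gain\<close> supplies exactly the
        difference between the two \<open>\<alpha>\<close> terms.\<close>
      have "\<beta> D i n * gain n = \<alpha> D i n k - \<alpha> D i n k'"
        using IJ_pos[of i n] mn 1 by (simp add: gain_def)
      then have g: "\<beta> D i n * (y n * gain n) = y n * (\<alpha> D i n k - \<alpha> D i n k')"
        by (metis mult.left_commute)
      have "((lam D i n * q i k - \<nu> D k * d i n k) + s * (lam D i n * q i k' - \<nu> D k' * d i n k'),
         \<nu> D k * d i n k + s * (\<nu> D k' * d i n k'),
         (\<beta> D i n * \<nu> D k * u i n k - \<alpha> D i n k * \<nu> D k * d i n k)
          + s * (\<beta> D i n * \<nu> D k' * u i n k' - \<alpha> D i n k' * \<nu> D k' * d i n k')) \<in> K_exp"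
        using cone[of i n k] cone[of i n k'] mn 1 kk s by (intro K_exp_add K_exp_scale) auto
      moreover have "(\<beta> D i n * \<nu> D k * u i n k - \<alpha> D i n k * \<nu> D k * d i n k)
          + s * (\<beta> D i n * \<nu> D k' * u i n k' - \<alpha> D i n k' * \<nu> D k' * d i n k')
        = \<beta> D i n * (\<nu> D k * u' i n k) - \<alpha> D i n k * (\<nu> D k * d' i n k)"
      proof -
        have "\<beta> D i n * (\<nu> D k * u' i n k) = \<beta> D i n * (\<nu> D k * u i n k)
            + s * (\<beta> D i n * (\<nu> D k' * u i n k') + \<beta> D i n * (y n * gain n))"
          unfolding new by (simp add: algebra_simps)
        then show ?thesis unfolding g new by (simp add: y_def algebra_simps)
      qed
      moreover have "(lam D i n * q i k - \<nu> D k * d i n k) + s * (lam D i n * q i k' - \<nu> D k' * d i n k')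
        = lam D i n * q' i k - \<nu> D k * d' i n k"
        unfolding new by (simp add: algebra_simps)
      ultimately show ?thesis using 1 new(2) by (simp add: mult.assoc)
    next
      case 2
      have new: "q' i k' = (1 - s) * q i k'" "d' i n k' = (1 - s) * d i n k'" "u' i n k' = (1 - s) * u i n k'"
        using k(2) by (simp_all add: q'_def d'_def u'_def algebra_simps)
      \<comment> \<open>At \<open>k'\<close> all entries scale by \<open>1 - s\<close>.\<close>
      have "((1 - s) * (lam D i n * q i k' - \<nu> D k' * d i n k'), (1 - s) * (\<nu> D k' * d i n k'),
         (1 - s) * (\<beta> D i n * \<nu> D k' * u i n k' - \<alpha> D i n k' * \<nu> D k' * d i n k')) \<in> K_exp"
        using cone[of i n k'] mn 2 kk s by (intro K_exp_scale) auto
      then show ?thesis unfolding 2 new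
        by (rule back_subst[of "\<lambda>v. v \<in> K_exp"]) (simp add: algebra_simps)
    next
      case 3
      then show ?thesis using cone[OF mn l] by (auto simp: q'_def d'_def u'_def)
    qed
  qed
  then have le: "CP1_objective D d' e u' \<le> CP1_objective D d e u"
    using opt unfolding CP1_optimal_def by blast
  let ?V = "\<lambda>d u (m, n). \<Sum>l=1..K D m. \<nu> D l * u m n l - \<nu> D l * \<phi> D m n l * d m n l"
  \<comment> \<open>Each moved trip earns the price increase plus the saved cost.\<close>
  have V: "?V d' u' (i, n) = ?V d u (i, n) + s * y n * (gain n + (\<phi> D i n k' - \<phi> D i n k))" for n
  proof -
    have "(\<Sum>l=1..K D i. \<nu> D l * \<phi> D i n l * d' i n l) = (\<Sum>l=1..K D i. \<nu> D l * \<phi> D i n l * d i n l)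
        + s * y n * (\<phi> D i n k - \<phi> D i n k')"
      using d'_sum[of "\<lambda>l. \<nu> D l * \<phi> D i n l" n] nu by (simp add: y_def algebra_simps)
    then show ?thesis using u'_sum[of n] by (simp add: sum_subtractf algebra_simps)
  qed
  have improve: "gain n + (\<phi> D i n k' - \<phi> D i n k) > 0" if "(i, n) \<in> IJ D" for n
    using gain[OF that] phi_le[OF that k] by simp
  have "(\<Sum>mn\<in>IJ D. ?V d u mn) < (\<Sum>mn\<in>IJ D. ?V d' u' mn)"
  proof (rule sum_strict_mono_ex1)
    show "\<forall>mn\<in>IJ D. ?V d u mn \<le> ?V d' u' mn"
    proof
      fix mn assume "mn \<in> IJ D"
      moreover obtain m n where "mn = (m, n)" by (cases mn)
      ultimately have mn: "(m, n) \<in> IJ D" "mn = (m, n)" by auto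
      show "?V d u mn \<le> ?V d' u' mn"
      proof (cases "m = i")
        case True
        have "0 \<le> s * y n * (gain n + (\<phi> D i n k' - \<phi> D i n k))"
          using mn True s y0[of n] improve[of n] by (intro mult_nonneg_nonneg) auto
        then show ?thesis unfolding mn(2) True V by linarith
      next
        case False
        then show ?thesis unfolding mn(2) by (simp add: d'_def u'_def)
      qed
    qed
    \<comment> \<open>Strictness comes from destination \<open>j\<close>: positive probability at
      \<open>k'\<close> means positive demand, so trips really are moved.\<close>
    have "d i j k' > 0" by (rule CP1_optimal_demand_pos[OF opt ij kk(2) q])
    then have "0 < s * y j * (gain j + (\<phi> D i j k' - \<phi> D i j k))"
      using nu s improve[OF ij] by (simp add: y_def)
    then have "?V d u (i, j) < ?V d' u' (i, j)" unfolding V by linarith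
    then show "\<exists>mn\<in>IJ D. ?V d u mn < ?V d' u' mn" using ij by blast
  qed simp
  then show False using le unfolding CP1_objective_def by linarith
qed

text \<open>Slack at \<open>k\<close> persists outward while the later entries of \<open>q\<close>
  vanish, as the partial sums stay put and the load grows. Either it reaches the last ring and
  \<open>q i k\<close> can be raised, or the first nonzero later ring can be shifted to
  \<open>k\<close>.\<close>

lemma CP1_optimal_tight_if_dest:
  assumes opt: "CP1_optimal D a d e f u q" and ij: "(i, j) \<in> IJ D" and k: "k \<in> {1..K D i}"
  shows "exp (- load i k (a i)) = 1 - (\<Sum>k'=1..k. q i k')"
proof (rule ccontr)
  assume neq: "exp (- load i k (a i)) \<noteq> 1 - (\<Sum>k'=1..k. q i k')"
  have feas: "CP1_feasible D a d e f u q" using opt by (simp add: CP1_optimal_def)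
  have i: "i \<in> zones D" using IJ_zones[OF ij] by simp
  have a0: "a i \<ge> 0" using feas i by (auto simp: CP1_feasible_iff linear_constraints_def)
  define \<epsilon> where "\<epsilon> = 1 - (\<Sum>k'=1..k. q i k') - exp (- load i k (a i))"
  have "exp (- load i k (a i)) \<le> 1 - (\<Sum>k'=1..k. q i k')"
    using feas i k unfolding CP1_feasible_iff by blast
  with neq have \<epsilon>: "\<epsilon> > 0" by (simp add: \<epsilon>_def)
  have slack: "exp (- load i l (a i)) \<le> 1 - (\<Sum>k'=1..l. q i k') - \<epsilon>"
    if l: "l \<in> {k..K D i}" and zero: "\<forall>l'\<in>{k<..l}. q i l' = 0" for l
  proof -
    have "(\<Sum>k'=1..l. q i k') = (\<Sum>k'=1..k. q i k')"
      using l zero k by (intro sum.mono_neutral_right) auto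
    moreover have "exp (- load i l (a i)) \<le> exp (- load i k (a i))"
      using load_mono_index[OF i, of k l "a i"] l k a0 by simp
    ultimately show ?thesis by (simp add: \<epsilon>_def)
  qed
  show False
  proof (cases "\<forall>l\<in>{k<..K D i}. q i l = 0")
    case True
    show False
      by (rule CP1_optimal_probability_maximal[OF opt ij k \<epsilon>]) (rule slack, use True in auto)
  next
    case False
    define P where "P l \<longleftrightarrow> l \<in> {k<..K D i} \<and> q i l \<noteq> 0" for l
    \<comment> \<open>Minimality makes \<open>q\<close> vanish strictly between \<open>k\<close> and
      \<open>k'\<close>, so the slack holds at every ring whose partial sum the shift
      enlarges.\<close>
    define k' where "k' = (LEAST l. P l)"
    have "\<exists>l. P l" using False by (auto simp: P_def)
    then have "P k'" unfolding k'_def by (rule LeastI_ex)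
    then have k': "k < k'" "k' \<le> K D i" "q i k' \<noteq> 0" by (auto simp: P_def)
    have least: "\<not> P l" if "l < k'" for l using not_less_Least that by (simp add: k'_def)
    have "q i k' \<ge> 0" using feas i k k' unfolding CP1_feasible_iff by auto
    then have q: "q i k' > 0" using k' by simp
    \<comment> \<open>The moved probability \<open>s * q i k'\<close> must fit into the slack, and
      the fraction must not exceed 1.\<close>
    define s where "s = min 1 (\<epsilon> / q i k')"
    have s: "0 < s" "s \<le> 1" using \<epsilon> q by (auto simp: s_def)
    have "s * q i k' \<le> \<epsilon> / q i k' * q i k'" using q by (intro mult_right_mono) (auto simp: s_def)
    then have sq: "s * q i k' \<le> \<epsilon>" using q by simp
    show False
    proof (rule CP1_optimal_no_shift[where s = s, OF opt ij _ k'(1,2) s q])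
      fix l assume l: "l \<in> {k..<k'}"
      have "\<forall>l'\<in>{k<..l}. q i l' = 0" using l least k' by (force simp: P_def)
      then show "exp (- load i l (a i)) \<le> 1 - (\<Sum>k'=1..l. q i k') - s * q i k'"
        using slack[of l] l k' sq by auto
    qed (use k in auto)
  qed
qed

text \<open>Idle drivers in a zone without passenger destinations could wait, at no loss, in a zone
  that has some; there they would create slack.\<close>

lemma CP1_optimal_tight:
  assumes opt: "CP1_optimal D a d e f u q" and i: "i \<in> zones D" and k: "k \<in> {1..K D i}"
  shows "exp (- load i k (a i)) = 1 - (\<Sum>k'=1..k. q i k')"
proof (cases "dest D i = {}")
  case False
  then obtain j where "(i, j) \<in> IJ D" using i by (auto simp: IJ_def)
  then show ?thesis by (rule CP1_optimal_tight_if_dest[OF opt _ k])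
next
  case True
  have feas: "CP1_feasible D a d e f u q" using opt by (simp add: CP1_optimal_def)
  have lin: "linear_constraints D a d e f" using feas by (simp add: CP1_feasible_iff)
  have a0: "a m \<ge> 0" if "m \<in> zones D" for m using lin that by (auto simp: linear_constraints_def)
  have Q: "exp (- load m l (a m)) \<le> 1 - (\<Sum>k'=1..l. q m k')" if "m \<in> zones D" "l \<in> {1..K D m}" for m l
    using feas that unfolding CP1_feasible_iff by blast
  have q0: "q m l \<ge> 0" if "m \<in> zones D" "l \<in> {1..K D m}" for m l
    using feas that unfolding CP1_feasible_iff by blast
  obtain i0 j0 where ij0: "(i0, j0) \<in> IJ D" using valid by (auto simp: valid_data_def)
  have i0: "i0 \<in> zones D" using IJ_zones[OF ij0] by simp
  have ne: "(i, n) \<notin> IJ D" for n using True by (simp add: IJ_def)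
  then have ii0: "i \<noteq> i0" using ij0 by auto
  have K0: "1 \<in> {1..K D i0}" using valid i0 by (auto simp: valid_data_def)
  \<comment> \<open>All idle drivers of \<open>i\<close> move to \<open>i0\<close>. Setting
    \<open>q\<close> to 0 at \<open>i\<close> keeps its pickup constraints valid, and no passenger
    trips start there.\<close>
  define a' where "a' m = a m + (if m = i0 then a i else 0) - (if m = i then a i else 0)" for m
  define q' where "q' m l = (if m = i then 0 else q m l)" for m l
  have a': "a' m \<ge> 0" if "m \<in> zones D" for m
    using a0[OF that] a0[OF i] by (auto simp: a'_def)
  have a'_ge: "a' m \<ge> a m" if "m \<noteq> i" for m
    using that a0[OF i] by (auto simp: a'_def)
  have "CP1_feasible D a' d e f u q'"
    unfolding CP1_feasible_iff ball_case_prod_iff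
  proof (intro conjI ballI allI impI)
    have "(\<Sum>m\<in>zones D. a' m) = (\<Sum>m\<in>zones D. a m)"
      unfolding a'_def sum_subtractf sum.distrib using i i0 by (simp add: sum.delta)
    then show "linear_constraints D a' d e f"
      using lin a' by (simp add: linear_constraints_def sum.distrib)
  next
    fix m l assume m: "m \<in> zones D" and l: "l \<in> {1..K D m}"
    show "q' m l \<ge> 0" using q0[OF m l] by (simp add: q'_def)
    show "exp (- load m l (a' m)) \<le> 1 - (\<Sum>k'=1..l. q' m k')"
    proof (cases "m = i")
      case True
      then show ?thesis using ii0 by (simp add: a'_def q'_def)
    next
      case False
      then have "exp (- load m l (a' m)) \<le> exp (- load m l (a m))"
        using load_mono[OF m a'_ge] by simp
      then have "exp (- load m l (a' m)) \<le> 1 - (\<Sum>k'=1..l. q m k')" using Q[OF m l] by linarith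
      then show ?thesis using False by (simp add: q'_def)
    qed
  next
    fix m n l assume mn: "(m, n) \<in> IJ D" and l: "l \<in> {1..K D m}"
    then have "m \<noteq> i" using ne by auto
    then show "(lam D m n * q' m l - \<nu> D l * d m n l, \<nu> D l * d m n l,
         \<beta> D m n * \<nu> D l * u m n l - \<alpha> D m n l * \<nu> D l * d m n l) \<in> K_exp"
      using feas mn l unfolding CP1_feasible_iff ball_case_prod_iff q'_def by simp
  qed
  then have "CP1_optimal D a' d e f u q'" by (rule CP1_optimal_same_value[OF opt])
  then have "exp (- load i0 1 (a' i0)) = 1 - (\<Sum>k'=1..1. q' i0 k')"
    by (rule CP1_optimal_tight_if_dest[OF _ ij0 K0])
  also have "\<dots> = 1 - (\<Sum>k'=1..1. q i0 k')" using ii0 by (simp add: q'_def)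
  \<comment> \<open>Tightness after the move, against the old inequality with the same
    \<open>q\<close> at \<open>i0\<close>, shows that no idle mass arrived; hence
    \<open>a i = 0\<close>.\<close>
  finally have "exp (- load i0 1 (a i0)) \<le> exp (- load i0 1 (a' i0))" using Q[OF i0 K0] by simp
  then have "\<not> a i0 < a' i0" using load_strict_mono[OF i0 K0, of "a i0" "a' i0"] by auto
  then have "a i = 0" using a0[OF i] ii0 by (auto simp: a'_def)
  \<comment> \<open>At load 0 the constraint says that this sum is at most 0, so both sides equal
    1.\<close>
  moreover have "(\<Sum>k'=1..k. q i k') \<ge> 0" using q0[OF i] k by (intro sum_nonneg) auto
  ultimately show ?thesis using Q[OF i k] by simp
qed

text \<open>Maximal revenue makes the cone constraint an equality, which says that the odds
  \<open>exp (\<alpha> - \<beta> x)\<close> equal \<open>y / z\<close>, with \<open>y\<close> the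
  served rate and \<open>z\<close> the rest of \<open>lam D i j * q i k\<close>. Without demand,
  \<open>q i k = 0\<close> and both sides vanish.\<close>

lemma CP1_optimal_logit:
  assumes opt: "CP1_optimal D a d e f u q" and ij: "(i, j) \<in> IJ D" and k: "k \<in> {1..K D i}"
    and x: "x = (if d i j k > 0 then u i j k / d i j k else 0)"
  shows "lam D i j * q i k * (exp (\<alpha> D i j k - \<beta> D i j * x) / (1 + exp (\<alpha> D i j k - \<beta> D i j * x)))
    = \<nu> D k * d i j k"
proof (cases "d i j k > 0")
  case False
  have feas: "CP1_feasible D a d e f u q" using opt by (simp add: CP1_optimal_def)
  then have "d i j k \<ge> 0" "q i k \<ge> 0" using ij k IJ_zones[OF ij]
    by (auto simp: CP1_feasible_iff linear_constraints_def ball_case_prod_iff)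
  then show ?thesis using False CP1_optimal_demand_pos[OF opt ij k] by force
next
  case True
  have feas: "CP1_feasible D a d e f u q" using opt by (simp add: CP1_optimal_def)
  have nu: "\<nu> D k > 0" using nu_pos[of i k] IJ_zones[OF ij] k by simp
  have pos: "lam D i j > 0" "\<beta> D i j > 0" using IJ_pos[OF ij] by auto
  define y where "y = \<nu> D k * d i j k"
  have y: "y > 0" using nu True by (simp add: y_def)
  define z where "z = lam D i j * q i k - y"
  have "(z, y, \<beta> D i j * \<nu> D k * u i j k - \<alpha> D i j k * \<nu> D k * d i j k) \<in> K_exp"
    using feas ij k unfolding CP1_feasible_iff ball_case_prod_iff y_def z_def by blast
  then have z: "z > 0" and le: "\<beta> D i j * \<nu> D k * u i j k - \<alpha> D i j k * y \<le> y * ln (z / y)"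
    using y by (auto simp: K_exp_pos_iff y_def mult.assoc)
  define v where "v = (\<alpha> D i j k * y + y * ln (z / y)) / (\<beta> D i j * \<nu> D k)"
  have v: "\<beta> D i j * \<nu> D k * v = \<alpha> D i j k * y + y * ln (z / y)" using pos nu by (simp add: v_def)
  have "v \<le> u i j k"
  proof (rule CP1_optimal_revenue_maximal[OF opt ij k])
    have "(z, y, \<beta> D i j * \<nu> D k * v - \<alpha> D i j k * y) \<in> K_exp"
      using y z v by (simp add: K_exp_pos_iff)
    then show "(lam D i j * q i k - \<nu> D k * d i j k, \<nu> D k * d i j k,
         \<beta> D i j * \<nu> D k * v - \<alpha> D i j k * \<nu> D k * d i j k) \<in> K_exp"
      by (simp add: y_def z_def mult.assoc)
  qed
  then have "\<beta> D i j * \<nu> D k * v \<le> \<beta> D i j * \<nu> D k * u i j k"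
    using pos nu by (intro mult_left_mono) auto
  then have eq: "\<beta> D i j * \<nu> D k * u i j k = \<alpha> D i j k * y + y * ln (z / y)"
    using v le by linarith
  have "\<beta> D i j * \<nu> D k * u i j k = y * (\<beta> D i j * x)"
    using True by (simp add: x y_def)
  then have "y * (\<beta> D i j * x) = y * (\<alpha> D i j k + ln (z / y))" using eq by (simp only: distrib_left mult.commute)
  then have "\<alpha> D i j k - \<beta> D i j * x = - ln (z / y)" using y by simp
  then have ex: "exp (\<alpha> D i j k - \<beta> D i j * x) = y / z"
    using y z by (simp add: exp_minus)
  have "lam D i j * q i k = y + z" by (simp add: z_def)
  moreover have "(y + z) * (y / z / (1 + y / z)) = y"
  proof -
    have "1 + y / z = (y + z) / z" using z by (simp add: field_simps)
    then show ?thesis using y z by simp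
  qed
  ultimately show ?thesis unfolding ex by (simp add: y_def)
qed

section \<open>Embedding the original problem into the conic one\<close>

lemma CP1_feasible_of_FP1_feasible:
  assumes "FP1_feasible D a d e f x p q"
  shows "CP1_feasible D a d e f (\<lambda>i j k. d i j k * x i j k) q"
proof -
  have lin: "linear_constraints D a d e f" using assms by (simp add: FP1_feasible_def)
  have Q: "(\<Sum>k'=1..k. q i k') = 1 - exp (- load i k (a i))" if "i \<in> zones D" "k \<in> {1..K D i}" for i k
    using assms that unfolding FP1_feasible_def load_def by blast
  have a0: "a i \<ge> 0" if "i \<in> zones D" for i using lin that by (auto simp: linear_constraints_def)
  \<comment> \<open>Nonnegativity follows from the equations: consecutive partial sums differ by a
    difference of exponentials whose loads grow with the ring. Ring 1 is compared with load
    0.\<close>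
  have q0: "q i k \<ge> 0" if i: "i \<in> zones D" and k: "k \<in> {1..K D i}" for i k
  proof (cases "k = 1")
    case True
    then show ?thesis using Q[OF i k] load_mono[OF i a0[OF i], of k] by simp
  next
    case False
    then obtain l where l: "k = Suc l" "l \<in> {1..K D i}" using k by (cases k) auto
    have "q i k = (\<Sum>k'=1..k. q i k') - (\<Sum>k'=1..l. q i k')" by (simp add: l)
    also have "\<dots> = exp (- load i l (a i)) - exp (- load i k (a i))"
      using Q[OF i k] Q[OF i l(2)] by simp
    also have "\<dots> \<ge> 0" using load_mono_index[OF i, of l k "a i"] a0[OF i] l k by simp
    finally show ?thesis .
  qed
  show ?thesis
    unfolding CP1_feasible_iff ball_case_prod_iff
  proof (intro conjI ballI allI impI)
    fix i j k assume ij: "(i, j) \<in> IJ D" and k: "k \<in> {1..K D i}"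
    have i: "i \<in> zones D" using IJ_zones[OF ij] by simp
    have nu: "\<nu> D k > 0" using nu_pos[OF i k] .
    have lam: "lam D i j > 0" using IJ_pos[OF ij] by simp
    define E where "E = exp (\<alpha> D i j k - \<beta> D i j * x i j k)"
    define y where "y = \<nu> D k * d i j k"
    have E: "E > 0" by (simp add: E_def)
    have "p i j k = E / (1 + E)" "lam D i j * q i k * p i j k = y"
      using assms ij k unfolding FP1_feasible_def ball_case_prod_iff E_def y_def by blast+
    then have py: "lam D i j * q i k * (E / (1 + E)) = y" by simp
    \<comment> \<open>If \<open>q i k = 0\<close>, then \<open>y = 0\<close> and the triple is the
      origin. Otherwise the logit equation leaves \<open>y / E\<close> as first entry, and the cone
      inequality is an equality.\<close>
    have "(lam D i j * q i k - y, y, y * (\<beta> D i j * x i j k - \<alpha> D i j k)) \<in> K_exp"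
    proof (cases "q i k = 0")
      case True
      then show ?thesis using py by (simp add: K_exp_zero_iff)
    next
      case False
      then have q: "q i k > 0" using q0[OF i k] by simp
      have "E / (1 + E) > 0" using E by simp
      then have y: "y > 0" using py q lam by (metis mult_pos_pos)
      have rest: "lam D i j * q i k - y = y / E"
        using E py by (simp add: field_simps)
      have "ln (y / E / y) = \<beta> D i j * x i j k - \<alpha> D i j k"
        using y by (simp add: E_def ln_div)
      then show ?thesis unfolding rest using y E by (simp add: K_exp_pos_iff)
    qed
    then show "(lam D i j * q i k - \<nu> D k * d i j k, \<nu> D k * d i j k,
      \<beta> D i j * \<nu> D k * (d i j k * x i j k) - \<alpha> D i j k * \<nu> D k * d i j k) \<in> K_exp"
      unfolding y_def by (rule back_subst[of "\<lambda>v. v \<in> K_exp"]) (simp add: algebra_simps)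
  qed (use lin q0 Q in auto)
qed

end

section \<open>Transfer of optimality between the two problems\<close>

theorem theorem3p1:
  fixes D :: "'z ride_data"
    and a :: "'z \<Rightarrow> real"
    and d u x p :: "'z \<Rightarrow> 'z \<Rightarrow> nat \<Rightarrow> real"
    and e f :: "'z \<Rightarrow> 'z \<Rightarrow> real"
    and q :: "'z \<Rightarrow> nat \<Rightarrow> real"
  assumes "valid_data D"
    and "CP1_optimal D a d e f u q"
    and "\<And>i j k. (i, j) \<in> IJ D \<Longrightarrow> k \<in> {1..K D i} \<Longrightarrow>
           x i j k = (if d i j k > 0 then u i j k / d i j k else 0)"
    and "\<And>i j k. (i, j) \<in> IJ D \<Longrightarrow> k \<in> {1..K D i} \<Longrightarrow>
           p i j k = exp (\<alpha> D i j k - \<beta> D i j * x i j k)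
                     / (1 + exp (\<alpha> D i j k - \<beta> D i j * x i j k))"
  shows "FP1_optimal D a d e f x p q"
proof -
  interpret ride D by unfold_locales (rule assms(1))
  have feas: "CP1_feasible D a d e f u q"
    and best: "\<And>a' d' e' f' u' q'. CP1_feasible D a' d' e' f' u' q' \<Longrightarrow>
      CP1_objective D d' e' u' \<le> CP1_objective D d e u"
    using assms(2) unfolding CP1_optimal_def by blast+
  have lin: "linear_constraints D a d e f" using feas by (simp add: CP1_feasible_iff)
  have "FP1_feasible D a d e f x p q"
    unfolding FP1_feasible_def ball_case_prod_iff
  proof (intro conjI ballI allI impI)
    fix i k assume "i \<in> zones D" "k \<in> {1..K D i}"
    then show "(\<Sum>k'=1..k. q i k') = 1 - exp (- (\<omega> D * (\<delta> D k)\<^sup>2 * a i / \<sigma> D i))"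
      using CP1_optimal_tight[OF assms(2)] by (simp add: load_def)
  next
    fix i j k assume ij: "(i, j) \<in> IJ D" and k: "k \<in> {1..K D i}"
    show "lam D i j * q i k * p i j k = \<nu> D k * d i j k"
      unfolding assms(4)[OF ij k] by (rule CP1_optimal_logit[OF assms(2) ij k assms(3)[OF ij k]])
  qed (use lin assms(4) in auto)
  moreover have "FP1_objective D d' e' x' \<le> FP1_objective D d e x"
    if "FP1_feasible D a' d' e' f' x' p' q'" for a' d' e' f' x' p' q'
  proof -
    have "FP1_objective D d' e' x' = CP1_objective D d' e' (\<lambda>i j k. d' i j k * x' i j k)"
      by (simp add: FP1_objective_def CP1_objective_def algebra_simps)
    also have "\<dots> \<le> CP1_objective D d e u"
      by (rule best[OF CP1_feasible_of_FP1_feasible[OF that]])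
    also have "\<dots> \<le> FP1_objective D d e x"
    proof -
      have "\<nu> D k * u i j k - \<nu> D k * \<phi> D i j k * d i j k \<le> \<nu> D k * d i j k * (x i j k - \<phi> D i j k)"
        if ij: "(i, j) \<in> IJ D" and k: "k \<in> {1..K D i}" for i j k
      proof -
        have "d i j k \<ge> 0" using lin ij k by (auto simp: linear_constraints_def ball_case_prod_iff)
        \<comment> \<open>Equality when \<open>d i j k > 0\<close>; otherwise the right side is 0
          and the cone already forces \<open>u i j k \<le> 0\<close>.\<close>
        then have "u i j k \<le> d i j k * x i j k"
          using CP1_feasible_d_zeroD[OF feas ij k] assms(3)[OF ij k] by (cases "d i j k = 0") auto
        then have "\<nu> D k * u i j k \<le> \<nu> D k * (d i j k * x i j k)"
          using nu_pos[of i k] IJ_zones[OF ij] k by (intro mult_left_mono) auto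
        then show ?thesis by (simp add: algebra_simps)
      qed
      then have "(\<Sum>(i, j)\<in>IJ D. \<Sum>k=1..K D i. \<nu> D k * u i j k - \<nu> D k * \<phi> D i j k * d i j k)
        \<le> (\<Sum>(i, j)\<in>IJ D. \<Sum>k=1..K D i. \<nu> D k * d i j k * (x i j k - \<phi> D i j k))"
        by (intro sum_mono) (auto intro!: sum_mono)
      then show ?thesis unfolding FP1_objective_def CP1_objective_def by linarith
    qed
    finally show ?thesis .
  qed
  ultimately show ?thesis unfolding FP1_optimal_def by blast
qed

end
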